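(* Let $k\ge 1$ and let $\mathbb{S}^{8k}$ be the standard round sphere. Let $\Psi$ be a generalized Killing spinor on $\mathbb{S}^{8k}$, with decomposition $\Psi=\Psi^++\Psi^-$ into positive and negative half-spinors. Let $\eta$ be the one-form (equivalently, vector field) on $\mathbb{S}^{8k}$ defined by $$g(\eta,X)=\langle X\cdot\Psi^+,\Psi^-\rangle,\qquad\forall\, X\in T\mathbb{S}^{8k}.$$ If $\eta$ is non-vanishing on a dense subset of $\mathbb{S}^{8k}$, then $\Psi$ is a Killing spinor.
   Context: Spheres $\mathbb{S}^n$ carry the round metric $g$ of constant sectional curvature $1$ and their spin structure. $\Sigma M$ denotes the real spinor bundle of a Riemannian spin manifold $(M^n,g)$ (associated to the real spin representation $\Sigma_n$, an irreducible real module over the real Clifford algebra $\mathrm{Cl}_n$), with the connection $\nabla$ induced by the Levi-Civita connection and a $\nabla$-parallel Euclidean scalar product $\langle\cdot,\cdot\rangle$. Clifford multiplication by tangent vectors is skew-symmetric and satisfies $X\cdot Y\cdot+Y\cdot X\cdot=-2g(X,Y)\mathrm{id}$. A generalized Killing spinor is a non-zero spinor field $\Psi\in\Gamma(\Sigma M)$ satisfying $\nabla_X\Psi=A(X)\cdot\Psi$ for all tangent vectors $X$, where $A$ is some symmetric endomorphism field of $TM$. It is called a Killing spinor if $A=\lambda\,\mathrm{id}$ for a non-zero real constant $\lambda$. In dimension $8k$ the real spin representation splits as $\Sigma_{8k}=\Sigma_{8k}^+\oplus\Sigma_{8k}^-$, the $\pm1$-eigenspaces of Clifford multiplication by the volume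 element; these are interchanged by Clifford multiplication with vectors. $\Psi^\pm$ are the corresponding components of $\Psi$. *)

theory Defs
  imports "HOL-Analysis.Analysis"
begin

text \<open>
  \<open>\<real>\<^sup>n\<close> is \<^typ>\<open>real ^ 'n::finite\<close> and the sphere of dimension \<open>n\<close> is the unit sphere of
  \<^typ>\<open>real ^ ('n::finite option)\<close>.  Tangent vectors at \<open>x\<close> are the vectors orthogonal to \<open>x\<close>.
\<close>

section \<open>Smooth maps\<close>

text \<open>For open \<open>U\<close>, \<open>Ck_on k U f\<close> says that \<open>f\<close> is \<open>k\<close> times continuously differentiable on \<open>U\<close>.\<close>

primrec Ck_on ::
  "nat \<Rightarrow> 'a::euclidean_space set \<Rightarrow> ('a \<Rightarrow> 'b::real_normed_vector) \<Rightarrow> bool" where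
  "Ck_on 0 U f \<longleftrightarrow> continuous_on U f"
| "Ck_on (Suc k) U f \<longleftrightarrow>
     f differentiable_on U \<and> (\<forall>v. Ck_on k U (\<lambda>x. frechet_derivative f (at x) v))"

text \<open>Smoothness on a subset of Euclidean space: locally the restriction of a smooth map.\<close>

definition smooth_on_subset ::
  "'a::euclidean_space set \<Rightarrow> ('a \<Rightarrow> 'b::real_normed_vector) \<Rightarrow> bool" where
  "smooth_on_subset U f \<longleftrightarrow>
     (\<forall>x\<in>U. \<exists>W g. open W \<and> x \<in> W \<and> (\<forall>k. Ck_on k W g) \<and> (\<forall>y\<in>W \<inter> U. g y = f y))"

text \<open>
  Derivative at \<open>x\<close> of a function on (an open part of) the unit sphere in the tangent
  direction \<open>X\<close>, along the curve \<open>t \<mapsto> (x + t X) / \<bar>x + t X\<bar>\<close>, which has velocity \<open>X\<close> at \<open>x\<close>.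
\<close>

definition sphere_deriv ::
  "('a::real_normed_vector \<Rightarrow> 'b::real_normed_vector) \<Rightarrow> 'a \<Rightarrow> 'a \<Rightarrow> 'b" where
  "sphere_deriv f x X = vector_derivative (\<lambda>t. f (sgn (x + t *\<^sub>R X))) (at 0)"

section \<open>The real spin representation\<close>

definition clifford_module :: "(real ^ 'n \<Rightarrow> 's::euclidean_space \<Rightarrow> 's) \<Rightarrow> bool" where
  "clifford_module cl \<longleftrightarrow>
     bilinear cl \<and>
     (\<forall>v w \<phi>. cl v (cl w \<phi>) + cl w (cl v \<phi>) = (- 2 * (v \<bullet> w)) *\<^sub>R \<phi>)"

text \<open>An irreducible Clifford module with a scalar product making Clifford multiplication skew.\<close>

definition real_spin_module :: "(real ^ 'n \<Rightarrow> 's::euclidean_space \<Rightarrow> 's) \<Rightarrow> bool" where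
  "real_spin_module cl \<longleftrightarrow>
     clifford_module cl \<and>
     (\<forall>V. subspace V \<and> (\<forall>v. \<forall>\<phi>\<in>V. cl v \<phi> \<in> V) \<longrightarrow> V = {0} \<or> V = UNIV) \<and>
     (\<forall>v \<phi> \<psi>. cl v \<phi> \<bullet> \<psi> = - (\<phi> \<bullet> cl v \<psi>))"

definition cl_prod :: "('v \<Rightarrow> 's \<Rightarrow> 's) \<Rightarrow> 'v list \<Rightarrow> 's \<Rightarrow> 's" where
  "cl_prod cl vs = foldr (\<lambda>v T. cl v \<circ> T) vs id"

text \<open>
  The volume element, for the orientation of \<open>\<real>\<^sup>n\<close> given by the enumeration \<open>es\<close> of the
  standard basis.
\<close>

definition volume_element :: "(real ^ 'n \<Rightarrow> 's \<Rightarrow> 's) \<Rightarrow> 'n list \<Rightarrow> 's \<Rightarrow> 's" where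
  "volume_element cl es = cl_prod cl (map (\<lambda>i. axis i 1) es)"

definition half_spinors ::
  "(real ^ 'n \<Rightarrow> 's::real_vector \<Rightarrow> 's) \<Rightarrow> 'n list \<Rightarrow> real \<Rightarrow> 's set" where
  "half_spinors cl es \<epsilon> = {\<phi>. volume_element cl es \<phi> = \<epsilon> *\<^sub>R \<phi>}"

text \<open>
  Spin(n), consisting of the products of an even number of unit vectors in the Clifford
  algebra.  For even \<open>n\<close> the Clifford algebra is simple, hence acts faithfully on the spin
  module, and the group is realised by the corresponding endomorphisms.
\<close>

definition Spin :: "(real ^ 'n \<Rightarrow> 's \<Rightarrow> 's) \<Rightarrow> ('s \<Rightarrow> 's) set" where
  "Spin cl = {cl_prod cl vs | vs. even (length vs) \<and> (\<forall>v\<in>set vs. norm v = 1)}"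

text \<open>The double covering of SO(n) by Spin(n): \<open>h v h\<^sup>-\<^sup>1\<close> in the Clifford algebra.\<close>

definition vector_rep :: "(real ^ 'n \<Rightarrow> 's \<Rightarrow> 's) \<Rightarrow> ('s \<Rightarrow> 's) \<Rightarrow> real ^ 'n \<Rightarrow> real ^ 'n" where
  "vector_rep cl h v = (THE w. cl w = h \<circ> cl v \<circ> inv h)"

section \<open>Spin structures on the sphere\<close>

text \<open>
  The bundle of oriented orthonormal frames of the sphere is the set of rotation matrices
  \<open>Q\<close>: the column \<^term>\<open>None\<close> is the base point (and outward unit normal) and the columns
  \<^term>\<open>Some i\<close> are the frame vectors.
\<close>

definition base_point :: "real ^ ('n::finite option) ^ ('n option) \<Rightarrow> real ^ ('n option)" where
  "base_point Q = column None Q"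

definition frame_vec :: "real ^ ('n::finite option) ^ ('n option) \<Rightarrow> 'n \<Rightarrow> real ^ ('n option)" where
  "frame_vec Q i = column (Some i) Q"

definition frame_map ::
  "real ^ ('n::finite option) ^ ('n option) \<Rightarrow> real ^ 'n \<Rightarrow> real ^ ('n option)" where
  "frame_map Q v = (\<Sum>i\<in>UNIV. (v $ i) *\<^sub>R frame_vec Q i)"

definition frame_coords ::
  "real ^ ('n::finite option) ^ ('n option) \<Rightarrow> real ^ ('n option) \<Rightarrow> real ^ 'n" where
  "frame_coords Q X = (\<chi> i. frame_vec Q i \<bullet> X)"

text \<open>
  A spin structure: a principal Spin(n)-bundle \<open>P\<close> over the sphere with right action \<open>act\<close>,
  and an equivariant two-sheeted covering \<open>F\<close> of the oriented orthonormal frame bundle.  The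
  projection to the sphere is \<open>p \<mapsto> base_point (F p)\<close>; local triviality is a consequence of the
  covering property, and the smooth structure of \<open>P\<close> is the one lifted along \<open>F\<close>.
\<close>

definition spin_structure ::
  "(real ^ 'n::finite \<Rightarrow> 's::euclidean_space \<Rightarrow> 's) \<Rightarrow> 'p::topological_space set
    \<Rightarrow> ('p \<Rightarrow> real ^ ('n option) ^ ('n option)) \<Rightarrow> ('p \<Rightarrow> ('s \<Rightarrow> 's) \<Rightarrow> 'p) \<Rightarrow> bool" where
  "spin_structure cl P F act \<longleftrightarrow>
     covering_space P F {Q. rotation_matrix Q} \<and>
     (\<forall>Q. rotation_matrix Q \<longrightarrow> card {p \<in> P. F p = Q} = 2) \<and>
     continuous_on (P \<times> Spin cl) (\<lambda>(p, h). act p h) \<and>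
     (\<forall>p\<in>P. \<forall>h\<in>Spin cl. act p h \<in> P) \<and>
     (\<forall>p\<in>P. act p id = p) \<and>
     (\<forall>p\<in>P. \<forall>g\<in>Spin cl. \<forall>h\<in>Spin cl. act (act p g) h = act p (g \<circ> h)) \<and>
     (\<forall>p\<in>P. \<forall>h\<in>Spin cl. act p h = p \<longrightarrow> h = id) \<and>
     (\<forall>p\<in>P. \<forall>q\<in>P. base_point (F p) = base_point (F q) \<longrightarrow> (\<exists>h\<in>Spin cl. act p h = q)) \<and>
     (\<forall>p\<in>P. \<forall>h\<in>Spin cl. base_point (F (act p h)) = base_point (F p) \<and>
        (\<forall>v. frame_map (F (act p h)) v = frame_map (F p) (vector_rep cl h v)))"

definition smooth_local_section ::
  "'p::topological_space set \<Rightarrow> ('p \<Rightarrow> real ^ ('n::finite option) ^ ('n option))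
    \<Rightarrow> (real ^ ('n option)) set \<Rightarrow> (real ^ ('n option) \<Rightarrow> 'p) \<Rightarrow> bool" where
  "smooth_local_section P F U s \<longleftrightarrow>
     openin (top_of_set (sphere 0 1)) U \<and>
     (\<forall>x\<in>U. s x \<in> P \<and> base_point (F (s x)) = x) \<and>
     continuous_on U s \<and> smooth_on_subset U (F \<circ> s)"

section \<open>Spinor fields\<close>

text \<open>
  Sections of the associated bundle are equivariant maps on \<open>P\<close>, so \<open>\<Psi>\<close> stands for the section
  \<open>x \<mapsto> [p, \<Psi> p]\<close>, where \<open>p\<close> is any point of \<open>P\<close> over \<open>x\<close>.
\<close>

definition spinor_field ::
  "(real ^ 'n::finite \<Rightarrow> 's::euclidean_space \<Rightarrow> 's) \<Rightarrow> 'p::topological_space set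
    \<Rightarrow> ('p \<Rightarrow> real ^ ('n option) ^ ('n option)) \<Rightarrow> ('p \<Rightarrow> ('s \<Rightarrow> 's) \<Rightarrow> 'p)
    \<Rightarrow> ('p \<Rightarrow> 's) \<Rightarrow> bool" where
  "spinor_field cl P F act \<Psi> \<longleftrightarrow>
     (\<forall>p\<in>P. \<forall>h\<in>Spin cl. \<Psi> (act p h) = inv h (\<Psi> p)) \<and>
     (\<forall>U s. smooth_local_section P F U s \<longrightarrow> smooth_on_subset U (\<Psi> \<circ> s))"

text \<open>Clifford multiplication \<open>X \<cdot> [p, \<phi>] = [p, cl_mult cl F p X \<phi>]\<close> by a tangent vector.\<close>

definition cl_mult ::
  "(real ^ 'n::finite \<Rightarrow> 's \<Rightarrow> 's) \<Rightarrow> ('p \<Rightarrow> real ^ ('n option) ^ ('n option)) \<Rightarrow> 'p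
    \<Rightarrow> real ^ ('n option) \<Rightarrow> 's \<Rightarrow> 's" where
  "cl_mult cl F p X \<phi> = cl (frame_coords (F p) X) \<phi>"

text \<open>
  The covariant derivative induced by the Levi-Civita connection, in the trivialisation by a
  local section \<open>s\<close> of \<open>P\<close> with frame \<open>e\<^sub>i\<close>:
  \<open>\<nabla>\<^sub>X [s, \<phi>] = [s, X(\<phi>) + 1/4 \<Sum>\<^sub>i\<^sub>j g(\<nabla>\<^sub>X e\<^sub>i, e\<^sub>j) E\<^sub>i E\<^sub>j \<phi>]\<close> with \<open>E\<^sub>i\<close> the standard basis of
  \<open>\<real>\<^sup>n\<close>.  As \<open>e\<^sub>j\<close> is tangent, \<open>\<nabla>\<^sub>X e\<^sub>i\<close>, which is the tangential part of the derivative of \<open>e\<^sub>i\<close>,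
  may be replaced by that derivative.
\<close>

definition spin_nabla ::
  "(real ^ 'n::finite \<Rightarrow> 's::euclidean_space \<Rightarrow> 's)
    \<Rightarrow> ('p \<Rightarrow> real ^ ('n option) ^ ('n option)) \<Rightarrow> (real ^ ('n option) \<Rightarrow> 'p)
    \<Rightarrow> ('p \<Rightarrow> 's) \<Rightarrow> real ^ ('n option) \<Rightarrow> real ^ ('n option) \<Rightarrow> 's" where
  "spin_nabla cl F s \<Psi> x X =
     sphere_deriv (\<Psi> \<circ> s) x X +
     (1/4) *\<^sub>R (\<Sum>i\<in>UNIV. \<Sum>j\<in>UNIV.
        (sphere_deriv (\<lambda>y. frame_vec (F (s y)) i) x X \<bullet> frame_vec (F (s x)) j) *\<^sub>R
          cl (axis i 1) (cl (axis j 1) (\<Psi> (s x))))"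

text \<open>
  Smooth symmetric endomorphism fields of the tangent bundle.  Smoothness is tested on the
  tangential projections of constant vectors; values off the tangent spaces are irrelevant.
\<close>

definition symmetric_endo_field ::
  "(real ^ 'm::finite \<Rightarrow> real ^ 'm \<Rightarrow> real ^ 'm) \<Rightarrow> bool" where
  "symmetric_endo_field A \<longleftrightarrow>
     (\<forall>x\<in>sphere 0 1. \<forall>X Y. X \<bullet> x = 0 \<and> Y \<bullet> x = 0 \<longrightarrow>
        A x X \<bullet> x = 0 \<and> A x (X + Y) = A x X + A x Y \<and> (\<forall>c. A x (c *\<^sub>R X) = c *\<^sub>R A x X) \<and>
        A x X \<bullet> Y = X \<bullet> A x Y) \<and>
     (\<forall>v. smooth_on_subset (sphere 0 1) (\<lambda>x. A x (v - (v \<bullet> x) *\<^sub>R x)))"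

definition generalized_killing_with ::
  "(real ^ 'n::finite \<Rightarrow> 's::euclidean_space \<Rightarrow> 's) \<Rightarrow> 'p::topological_space set
    \<Rightarrow> ('p \<Rightarrow> real ^ ('n option) ^ ('n option)) \<Rightarrow> ('p \<Rightarrow> ('s \<Rightarrow> 's) \<Rightarrow> 'p)
    \<Rightarrow> (real ^ ('n option) \<Rightarrow> real ^ ('n option) \<Rightarrow> real ^ ('n option))
    \<Rightarrow> ('p \<Rightarrow> 's) \<Rightarrow> bool" where
  "generalized_killing_with cl P F act A \<Psi> \<longleftrightarrow>
     symmetric_endo_field A \<and> spinor_field cl P F act \<Psi> \<and> (\<exists>p\<in>P. \<Psi> p \<noteq> 0) \<and>
     (\<forall>U s. smooth_local_section P F U s \<longrightarrow>
        (\<forall>x\<in>U. \<forall>X. X \<bullet> x = 0 \<longrightarrow>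
           spin_nabla cl F s \<Psi> x X = cl_mult cl F (s x) (A x X) (\<Psi> (s x))))"

definition generalized_killing_spinor ::
  "(real ^ 'n::finite \<Rightarrow> 's::euclidean_space \<Rightarrow> 's) \<Rightarrow> 'p::topological_space set
    \<Rightarrow> ('p \<Rightarrow> real ^ ('n option) ^ ('n option)) \<Rightarrow> ('p \<Rightarrow> ('s \<Rightarrow> 's) \<Rightarrow> 'p)
    \<Rightarrow> ('p \<Rightarrow> 's) \<Rightarrow> bool" where
  "generalized_killing_spinor cl P F act \<Psi> \<longleftrightarrow>
     (\<exists>A. generalized_killing_with cl P F act A \<Psi>)"

definition killing_spinor ::
  "(real ^ 'n::finite \<Rightarrow> 's::euclidean_space \<Rightarrow> 's) \<Rightarrow> 'p::topological_space set
    \<Rightarrow> ('p \<Rightarrow> real ^ ('n option) ^ ('n option)) \<Rightarrow> ('p \<Rightarrow> ('s \<Rightarrow> 's) \<Rightarrow> 'p)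
    \<Rightarrow> ('p \<Rightarrow> 's) \<Rightarrow> bool" where
  "killing_spinor cl P F act \<Psi> \<longleftrightarrow>
     (\<exists>c::real. c \<noteq> 0 \<and> generalized_killing_with cl P F act (\<lambda>x X. c *\<^sub>R X) \<Psi>)"

end

theory Submission
  imports Defs
begin

text \<open>
  Write \<open>f = |\<Psi>\<^sup>+|\<^sup>2 - |\<Psi>\<^sup>-|\<^sup>2\<close>.  As Clifford multiplication by vectors exchanges the half-spinors, the
  equation \<open>\<nabla>\<^sub>X \<Psi> = A X \<cdot> \<Psi>\<close> has two consequences.  At first order, \<open>X f = - 4 g(\<eta>, A X)\<close>
  (\<open>chirality_derivative\<close>).  At second order, the curvature of the spinor bundle is known, and this
  gives for all tangent vectors a vector \<open>T = (\<nabla>\<^sub>X A) Y - (\<nabla>\<^sub>Y A) X\<close> with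
    \<open>T \<cdot> \<Psi> = [A X, A Y] \<cdot> \<Psi> - 1/4 [X, Y] \<cdot> \<Psi>\<close>
  (\<open>curvature_identity\<close>).

  The rest is pointwise algebra.  Insert orthonormal eigenvectors \<open>e\<close>, \<open>e'\<close> of \<open>A\<close> with eigenvalues
  \<open>\<lambda>\<close>, \<open>\<mu>\<close>, so that the right-hand side becomes \<open>\<kappa> e \<cdot> e' \<cdot> \<Psi>\<close> with \<open>\<kappa> = 2 (\<lambda> \<mu> - 1/4)\<close>, split into half-spinors
  and take the scalar product with \<open>e \<cdot> \<Psi>\<^sup>\<plusminus>\<close>: the two results have opposite signs on the right, whence
  \<open>g(T, e) = 0\<close> and \<open>\<kappa> g(\<eta>, e') = 0\<close> (\<open>eigenpair_relation\<close>).  The scalar product with \<open>T \<cdot> \<Psi>\<^sup>\<plusminus>\<close> gives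
  \<open>f |T|\<^sup>2 = 0\<close> (\<open>eigenpair_vanishing\<close>).  If \<open>\<eta> \<noteq> 0\<close>, two conclusions follow (\<open>curvature_rigidity\<close>):
  \<open>A \<eta> \<noteq> 0\<close>, because \<open>A \<eta> = 0\<close> would give an eigenvalue \<open>\<mu> = 0\<close> with \<open>g(\<eta>, e') \<noteq> 0\<close>, contradicting
  \<open>\<lambda> \<mu> = 1/4\<close>; and where \<open>f \<noteq> 0\<close> the eigenvalues of any two members of an orthonormal
  eigenbasis have product \<open>1/4\<close>, which in dimension
  at least three forces \<open>A = 1/2\<close> or \<open>A = - 1/2\<close> at that point.

  By the first conclusion and the formula for \<open>X f\<close>, the function \<open>f\<close> vanishes on no neighbourhood of a point
  with \<open>\<eta> \<noteq> 0\<close>.  Such a point is therefore a limit of points where neither \<open>f\<close> nor \<open>\<eta>\<close> vanishes, since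
  the set \<open>\<eta> \<noteq> 0\<close> is dense and \<open>f \<noteq> 0\<close> is open.  Hence \<open>A\<close> is \<open>1/2\<close> or \<open>- 1/2\<close> on a dense
  set, by continuity everywhere, and the sign is constant because the sphere is connected.

  Both differential identities are computed at one point \<open>x\<^sub>0\<close>, in the local section of \<open>P\<close> whose frame is carried
  from \<open>x\<^sub>0\<close> along great circles.  Its connection form vanishes at \<open>x\<^sub>0\<close> and is explicit near
  \<open>x\<^sub>0\<close>, so that the curvature identity is the symmetry of the second derivative at
  \<open>x\<^sub>0\<close> of the spinor field, extended to a cone by homogeneity of degree \<open>0\<close>.
\<close>

section \<open>Smooth maps and second derivatives\<close>

text \<open>
  Differentiability on a set and the total function \<open>frechet_derivative\<close> depend only
  on the values on the set because the set is open.
\<close>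

lemma Ck_on_cong:
  assumes "open U" "\<And>x. x \<in> U \<Longrightarrow> f x = g x"
  shows "Ck_on k U f \<longleftrightarrow> Ck_on k U g"
  using assms(2)
proof (induction k arbitrary: f g)
  case 0
  then show ?case by (simp cong: continuous_on_cong)
next
  case (Suc k)
  have diff: "f differentiable_on U \<longleftrightarrow> g differentiable_on U"
    using Suc.prems unfolding differentiable_on_def
    by (metis differentiable_transform_within zero_less_one)
  show ?case
  proof (cases "f differentiable_on U")
    case True
    have "frechet_derivative f (at x) v = frechet_derivative g (at x) v" if "x \<in> U" for x v
      using frechet_derivative_transform_within_open[OF _ assms(1) that, of f g] True that Suc.prems assms(1)
      by (simp add: differentiable_on_eq_differentiable_at)
    then have "Ck_on k U (\<lambda>x. frechet_derivative f (at x) v) \<longleftrightarrow>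
        Ck_on k U (\<lambda>x. frechet_derivative g (at x) v)" for v
      by (intro Suc.IH) auto
    with diff show ?thesis by simp
  qed (use diff in simp)
qed

text \<open>
  Spares the use of \<open>frechet_derivative\<close>: any explicit formula for the derivative
  will do.
\<close>

lemma Ck_on_SucI:
  assumes "open U" "\<And>x. x \<in> U \<Longrightarrow> (f has_derivative f' x) (at x)"
    and "\<And>v. Ck_on k U (\<lambda>x. f' x v)"
  shows "Ck_on (Suc k) U f"
proof -
  have "f differentiable_on U"
    using assms(2) by (meson differentiable_at_imp_differentiable_on differentiableI)
  moreover have "Ck_on k U (\<lambda>x. frechet_derivative f (at x) v)" for v
    using Ck_on_cong[OF assms(1), of "\<lambda>x. frechet_derivative f (at x) v" "\<lambda>x. f' x v" k]
      assms(2,3) by (metis frechet_derivative_at)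
  ultimately show ?thesis by simp
qed

lemma Ck_on_Suc_lower: "Ck_on (Suc k) U f \<Longrightarrow> Ck_on k U f"
proof (induction k arbitrary: f)
  case 0
  then show ?case by (simp add: differentiable_imp_continuous_on)
next
  case (Suc k)
  then show ?case by (metis Ck_on.simps(2))
qed

lemma Ck_on_has_derivative:
  assumes "open U" "Ck_on (Suc k) U f" "x \<in> U"
  shows "(f has_derivative frechet_derivative f (at x)) (at x)"
  using assms by (simp add: differentiable_on_eq_differentiable_at frechet_derivative_works)

lemma Ck_on_const [simp]: "Ck_on k U (\<lambda>x. c)"
proof (induction k arbitrary: c)
  case (Suc k)
  then show ?case by (simp add: frechet_derivative_const)
qed simp

lemma Ck_on_linear:
  assumes "open U" "bounded_linear f"
  shows "Ck_on k U f"
proof (cases k)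
  case 0
  then show ?thesis using assms(2) by (simp add: linear_continuous_on)
next
  case (Suc j)
  then show ?thesis
    using Ck_on_SucI[OF assms(1), of f "\<lambda>_. f" j] assms(2) by (simp add: bounded_linear_imp_has_derivative)
qed

lemma Ck_on_add:
  assumes "open U" "Ck_on k U f" "Ck_on k U g"
  shows "Ck_on k U (\<lambda>x. f x + g x)"
  using assms(2,3)
proof (induction k arbitrary: f g)
  case 0
  then show ?case by (simp add: continuous_on_add)
next
  case (Suc k)
  show ?case
  proof (rule Ck_on_SucI[OF assms(1)])
    show "((\<lambda>x. f x + g x) has_derivative
        (\<lambda>v. frechet_derivative f (at x) v + frechet_derivative g (at x) v)) (at x)" if "x \<in> U" for x
      using Suc.prems assms(1) that by (intro has_derivative_add Ck_on_has_derivative[where k=k])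
    show "Ck_on k U (\<lambda>x. frechet_derivative f (at x) v + frechet_derivative g (at x) v)" for v
      using Suc by simp
  qed
qed

lemma Ck_on_bilinear:
  assumes "bounded_bilinear b" "open U" "Ck_on k U f" "Ck_on k U g"
  shows "Ck_on k U (\<lambda>x. b (f x) (g x))"
  using assms(3,4)
proof (induction k arbitrary: f g)
  case 0
  then show ?case by (simp add: bounded_bilinear.continuous_on[OF assms(1)])
next
  case (Suc k)
  show ?case
  proof (rule Ck_on_SucI[OF assms(2)])
    show "((\<lambda>x. b (f x) (g x)) has_derivative
        (\<lambda>v. b (f x) (frechet_derivative g (at x) v) + b (frechet_derivative f (at x) v) (g x))) (at x)"
      if "x \<in> U" for x
      using Suc.prems assms(2) that
      by (intro bounded_bilinear.FDERIV[OF assms(1)] Ck_on_has_derivative[where k=k])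
    show "Ck_on k U (\<lambda>x. b (f x) (frechet_derivative g (at x) v)
        + b (frechet_derivative f (at x) v) (g x))" for v
      using Suc.prems Ck_on_Suc_lower[OF Suc.prems(1)] Ck_on_Suc_lower[OF Suc.prems(2)]
      by (intro Ck_on_add[OF assms(2)] Suc.IH) simp_all
  qed
qed

lemma Ck_on_inverse:
  fixes f :: "'a::euclidean_space \<Rightarrow> real"
  assumes "open U" "\<And>x. x \<in> U \<Longrightarrow> f x \<noteq> 0" "Ck_on k U f"
  shows "Ck_on k U (\<lambda>x. inverse (f x))"
  using assms(3)
proof (induction k)
  case 0
  then show ?case using assms(2) by (simp add: continuous_on_inverse)
next
  case (Suc k)
  show ?case
  proof (rule Ck_on_SucI[OF assms(1)])
    show "((\<lambda>x. inverse (f x)) has_derivative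
        (\<lambda>v. - (inverse (f x) * frechet_derivative f (at x) v * inverse (f x)))) (at x)" if "x \<in> U" for x
      using Suc.prems assms that by (intro Deriv.has_derivative_inverse Ck_on_has_derivative[where k=k])
    show "Ck_on k U (\<lambda>x. - (inverse (f x) * frechet_derivative f (at x) v * inverse (f x)))" for v
    proof -
      have 1: "Ck_on k U (\<lambda>x. inverse (f x))"
        using Suc Ck_on_Suc_lower by blast
      have 2: "Ck_on k U (\<lambda>x. inverse (f x) * frechet_derivative f (at x) v * inverse (f x))"
        using Suc.prems by (intro Ck_on_bilinear[OF bounded_bilinear_mult assms(1)] 1) auto
      have "Ck_on k U (\<lambda>x. (- 1) * (inverse (f x) * frechet_derivative f (at x) v * inverse (f x)))"
        by (rule Ck_on_bilinear[OF bounded_bilinear_mult assms(1) Ck_on_const 2])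
      then show ?thesis by simp
    qed
  qed
qed

lemma Ck_on_sum:
  assumes "open U" "finite I" "\<And>i. i \<in> I \<Longrightarrow> Ck_on k U (f i)"
  shows "Ck_on k U (\<lambda>x. \<Sum>i\<in>I. f i x)"
  using assms(2,3) by (induction I rule: finite_induct) (auto intro: Ck_on_add[OF assms(1)])

lemma Ck_on_componentwise:
  fixes f :: "'a::euclidean_space \<Rightarrow> 'b::euclidean_space"
  assumes "open U" "\<And>b. b \<in> Basis \<Longrightarrow> Ck_on k U (\<lambda>x. f x \<bullet> b)"
  shows "Ck_on k U f"
proof -
  have "Ck_on k U (\<lambda>x. \<Sum>b\<in>Basis. (f x \<bullet> b) *\<^sub>R b)"
    by (intro Ck_on_sum assms Ck_on_bilinear[OF bounded_bilinear_scaleR] Ck_on_const finite_Basis)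
  then show ?thesis by (simp add: euclidean_representation)
qed

text \<open>
  The first-order part of smoothness, in the form used for calculus on the sphere.
\<close>

lemma smooth_on_subset_differentiable:
  assumes "smooth_on_subset U f" "x \<in> U"
  obtains W g where "open W" "x \<in> W" "\<And>y. y \<in> W \<Longrightarrow> g differentiable (at y)"
    "\<And>y. y \<in> W \<Longrightarrow> y \<in> U \<Longrightarrow> g y = f y"
proof -
  obtain W g where W: "open W" "x \<in> W" "\<forall>k. Ck_on k W g" "\<forall>y\<in>W \<inter> U. g y = f y"
    using assms unfolding smooth_on_subset_def by blast
  have "Ck_on (Suc 0) W g" using W(3) by blast
  then have "g differentiable (at y)" if "y \<in> W" for y
    using W(1) that by (simp add: differentiable_on_eq_differentiable_at)
  with W show ?thesis by (intro that[of W g]) auto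
qed

lemma smooth_on_subset_continuous:
  assumes "smooth_on_subset U f"
  shows "continuous_on U f"
  unfolding continuous_on_def
proof
  fix x assume "x \<in> U"
  obtain W g where W: "open W" "x \<in> W" "\<And>y. y \<in> W \<Longrightarrow> g differentiable (at y)"
    "\<And>y. y \<in> W \<Longrightarrow> y \<in> U \<Longrightarrow> g y = f y"
    using smooth_on_subset_differentiable[OF assms \<open>x \<in> U\<close>] by blast
  have "isCont g x" using W(2,3) differentiable_imp_continuous_within by blast
  then have "(g \<longlongrightarrow> f x) (at x within U)"
    using W(2,4) \<open>x \<in> U\<close> continuous_at_imp_continuous_at_within[of x g U] by (simp add: continuous_within)
  moreover have "\<forall>\<^sub>F y in at x within U. g y = f y"
    unfolding eventually_at_topological using W by blast
  ultimately show "(f \<longlongrightarrow> f x) (at x within U)" by (rule Lim_transform_eventually)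
qed

lemma smooth_on_subset_mono:
  assumes "smooth_on_subset U f" "V \<subseteq> U"
  shows "smooth_on_subset V f"
  unfolding smooth_on_subset_def
proof
  fix x assume "x \<in> V"
  then have "x \<in> U" using assms(2) by (rule rev_subsetD)
  from bspec[OF assms(1)[unfolded smooth_on_subset_def] this]
  obtain W g where "open W" "x \<in> W" "\<forall>k. Ck_on k W g" "\<forall>y\<in>W \<inter> U. g y = f y"
    by (elim exE conjE)
  then show "\<exists>W g. open W \<and> x \<in> W \<and> (\<forall>k. Ck_on k W g) \<and> (\<forall>y\<in>W \<inter> V. g y = f y)"
    using assms(2) by (intro exI[of _ W] exI[of _ g]) auto
qed

text \<open>
  The mean value theorem applied to \<open>\<theta> \<mapsto> f (x + \<theta> a + t b) - f (x +
  \<theta> a)\<close> on \<open>[0, t]\<close> expresses the second difference through the first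
  derivative in the direction \<open>a\<close>, whose linear approximation \<open>D\<close> at
  \<open>x\<close> then gives the term \<open>t\<^sup>2 D b\<close>.
\<close>

lemma second_difference_estimate:
  fixes f :: "'a::real_normed_vector \<Rightarrow> real"
  assumes "\<delta> > 0" "\<And>h. norm h < \<delta> \<Longrightarrow> (f has_derivative f' (x + h)) (at (x + h))"
    and est: "\<And>h. norm h < \<delta> \<Longrightarrow> \<bar>f' (x + h) a - f' x a - D h\<bar> \<le> \<epsilon> * norm h"
    and "linear D" "\<epsilon> \<ge> 0"
    and t: "t > 0" "t * (norm a + norm b) < \<delta>"
  shows "\<bar>f (x + t *\<^sub>R a + t *\<^sub>R b) - f (x + t *\<^sub>R a) - f (x + t *\<^sub>R b) + f x - t\<^sup>2 * D b\<bar>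
    \<le> 2 * \<epsilon> * t\<^sup>2 * (norm a + norm b)"
proof -
  define g where "g \<theta> = f (x + (\<theta> *\<^sub>R a + t *\<^sub>R b)) - f (x + \<theta> *\<^sub>R a)" for \<theta>
  have small: "norm (\<theta> *\<^sub>R a + t *\<^sub>R b) \<le> t * (norm a + norm b)"
      "norm (\<theta> *\<^sub>R a) \<le> t * (norm a + norm b)" if "0 \<le> \<theta>" "\<theta> \<le> t" for \<theta>
  proof -
    have "norm (\<theta> *\<^sub>R a + t *\<^sub>R b) \<le> \<theta> * norm a + t * norm b"
      using norm_triangle_ineq[of "\<theta> *\<^sub>R a" "t *\<^sub>R b"] that t by simp
    moreover have "\<theta> * norm a \<le> t * norm a" using that by (intro mult_right_mono) auto
    moreover have "0 \<le> t * norm b" using t by simp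
    moreover have "norm (\<theta> *\<^sub>R a) = \<theta> * norm a" using that by simp
    ultimately show "norm (\<theta> *\<^sub>R a + t *\<^sub>R b) \<le> t * (norm a + norm b)"
      "norm (\<theta> *\<^sub>R a) \<le> t * (norm a + norm b)"
      unfolding distrib_left by linarith+
  qed
  have der: "(g has_derivative
      (\<lambda>h. f' (x + (\<theta> *\<^sub>R a + t *\<^sub>R b)) (h *\<^sub>R a) - f' (x + \<theta> *\<^sub>R a) (h *\<^sub>R a))) (at \<theta>)"
    if "0 \<le> \<theta>" "\<theta> \<le> t" for \<theta>
    unfolding g_def
  proof (intro has_derivative_diff)
    have *: "norm (\<theta> *\<^sub>R a + t *\<^sub>R b) < \<delta>" "norm (\<theta> *\<^sub>R a) < \<delta>"
      using small[OF that] t by linarith+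
    show "((\<lambda>\<theta>. f (x + (\<theta> *\<^sub>R a + t *\<^sub>R b))) has_derivative
        (\<lambda>h. f' (x + (\<theta> *\<^sub>R a + t *\<^sub>R b)) (h *\<^sub>R a))) (at \<theta>)"
      using has_derivative_compose[where f = "\<lambda>\<theta>. x + (\<theta> *\<^sub>R a + t *\<^sub>R b)" and f' = "\<lambda>h. h *\<^sub>R a",
          OF _ assms(2)[OF *(1)], of UNIV] by (fastforce intro!: derivative_eq_intros)
    show "((\<lambda>\<theta>. f (x + \<theta> *\<^sub>R a)) has_derivative (\<lambda>h. f' (x + \<theta> *\<^sub>R a) (h *\<^sub>R a))) (at \<theta>)"
      using has_derivative_compose[where f = "\<lambda>\<theta>. x + \<theta> *\<^sub>R a" and f' = "\<lambda>h. h *\<^sub>R a",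
          OF _ assms(2)[OF *(2)], of UNIV] by (fastforce intro!: derivative_eq_intros)
  qed
  obtain \<xi> where \<xi>: "0 < \<xi>" "\<xi> < t" and mv: "g t - g 0 =
      f' (x + (\<xi> *\<^sub>R a + t *\<^sub>R b)) ((t - 0) *\<^sub>R a) - f' (x + \<xi> *\<^sub>R a) ((t - 0) *\<^sub>R a)"
  proof -
    have "continuous_on {0..t} g"
      using has_derivative_continuous[OF der] by (intro continuous_at_imp_continuous_on) simp
    moreover have "(g has_derivative
      (\<lambda>h. f' (x + (\<theta> *\<^sub>R a + t *\<^sub>R b)) (h *\<^sub>R a) - f' (x + \<theta> *\<^sub>R a) (h *\<^sub>R a))) (at \<theta>)"
      if "0 < \<theta>" "\<theta> < t" for \<theta> using der that by auto
    ultimately obtain \<xi> where "0 < \<xi>" "\<xi> < t" "g t - g 0 =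
      f' (x + (\<xi> *\<^sub>R a + t *\<^sub>R b)) ((t - 0) *\<^sub>R a) - f' (x + \<xi> *\<^sub>R a) ((t - 0) *\<^sub>R a)"
      using mvt[OF t(1), of g "\<lambda>\<theta> h. f' (x + (\<theta> *\<^sub>R a + t *\<^sub>R b)) (h *\<^sub>R a) - f' (x + \<theta> *\<^sub>R a) (h *\<^sub>R a)"]
      by blast
    then show ?thesis by (rule that)
  qed
  have s: "norm (\<xi> *\<^sub>R a + t *\<^sub>R b) < \<delta>" "norm (\<xi> *\<^sub>R a) < \<delta>"
    using small[of \<xi>] \<xi> t by auto
  define u where "u = f' (x + (\<xi> *\<^sub>R a + t *\<^sub>R b)) a - f' x a - D (\<xi> *\<^sub>R a + t *\<^sub>R b)"
  define v where "v = f' (x + \<xi> *\<^sub>R a) a - f' x a - D (\<xi> *\<^sub>R a)"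
  have lin: "f' (x + h) (t *\<^sub>R a) = t * f' (x + h) a" if "norm h < \<delta>" for h
    using has_derivative_linear[OF assms(2)[OF that]] by (simp add: linear_scale)
  have D: "D (\<xi> *\<^sub>R a + t *\<^sub>R b) = D (\<xi> *\<^sub>R a) + t * D b"
    using \<open>linear D\<close> by (simp add: linear_add linear_scale)
  have "g t - g 0 - t\<^sup>2 * D b = t * (u - v)"
    unfolding mv u_def v_def D using lin[OF s(1)] lin[OF s(2)] by (simp add: algebra_simps power2_eq_square)
  moreover have "\<bar>u - v\<bar> \<le> 2 * \<epsilon> * t * (norm a + norm b)"
  proof -
    have "\<bar>u\<bar> \<le> \<epsilon> * (t * (norm a + norm b))"
      using est[OF s(1)] small(1)[of \<xi>] \<xi> \<open>\<epsilon> \<ge> 0\<close> unfolding u_def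
      by (meson less_eq_real_def mult_left_mono order_trans)
    moreover have "\<bar>v\<bar> \<le> \<epsilon> * (t * (norm a + norm b))"
      using est[OF s(2)] small(2)[of \<xi>] \<xi> \<open>\<epsilon> \<ge> 0\<close> unfolding v_def
      by (meson less_eq_real_def mult_left_mono order_trans)
    ultimately show ?thesis by (simp add: algebra_simps)
  qed
  ultimately have "\<bar>g t - g 0 - t\<^sup>2 * D b\<bar> \<le> t * (2 * \<epsilon> * t * (norm a + norm b))"
    using t by (simp add: abs_mult)
  moreover have "g t - g 0 = f (x + t *\<^sub>R a + t *\<^sub>R b) - f (x + t *\<^sub>R a) - f (x + t *\<^sub>R b) + f x"
    by (simp add: g_def algebra_simps)
  ultimately show ?thesis by (simp add: power2_eq_square algebra_simps)
qed

text \<open>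
  The second difference is symmetric in \<open>a\<close> and \<open>b\<close>, so its leading
  coefficient can be computed in two ways.
\<close>

lemma symmetric_second_derivative_real:
  fixes f :: "'a::real_normed_vector \<Rightarrow> real"
  assumes "open S" "x \<in> S" and f: "\<And>y. y \<in> S \<Longrightarrow> (f has_derivative f' y) (at y)"
    and A: "((\<lambda>y. f' y a) has_derivative A) (at x)"
    and B: "((\<lambda>y. f' y b) has_derivative B) (at x)"
  shows "A b = B a"
proof -
  define c where "c = norm a + norm b"
  have "\<bar>A b - B a\<bar> \<le> \<epsilon> * (4 * c)" if eps: "\<epsilon> > 0" for \<epsilon>
  proof -
    obtain d1 where d1: "d1 > 0" "\<And>y. norm (y - x) < d1 \<Longrightarrow>
        norm (f' y a - f' x a - A (y - x)) \<le> \<epsilon> * norm (y - x)"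
      using has_derivative_within_alt[of _ _ x UNIV, THEN iffD1, OF A, THEN conjunct2, rule_format, OF eps] by auto
    obtain d2 where d2: "d2 > 0" "\<And>y. norm (y - x) < d2 \<Longrightarrow>
        norm (f' y b - f' x b - B (y - x)) \<le> \<epsilon> * norm (y - x)"
      using has_derivative_within_alt[of _ _ x UNIV, THEN iffD1, OF B, THEN conjunct2, rule_format, OF eps] by auto
    obtain d3 where d3: "d3 > 0" "ball x d3 \<subseteq> S"
      using assms(1,2) openE by blast
    define \<delta> where "\<delta> = min d1 (min d2 d3)"
    have \<delta>: "\<delta> > 0" using d1 d2 d3 by (simp add: \<delta>_def)
    have in_S: "(f has_derivative f' (x + h)) (at (x + h))" if "norm h < \<delta>" for h
      using that d3 by (intro f) (auto simp: \<delta>_def dist_norm)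
    have eA: "\<bar>f' (x + h) a - f' x a - A h\<bar> \<le> \<epsilon> * norm h" if "norm h < \<delta>" for h
      using d1(2)[of "x + h"] that by (simp add: \<delta>_def)
    have eB: "\<bar>f' (x + h) b - f' x b - B h\<bar> \<le> \<epsilon> * norm h" if "norm h < \<delta>" for h
      using d2(2)[of "x + h"] that by (simp add: \<delta>_def)
    define t where "t = \<delta> / (c + 1) / 2"
    have c: "c \<ge> 0" by (simp add: c_def)
    have t: "t > 0" using \<delta> c by (simp add: t_def)
    have tc: "t * c < \<delta>"
    proof -
      have "c / ((c + 1) * 2) < 1" using c by simp
      then have "\<delta> * (c / ((c + 1) * 2)) < \<delta> * 1" using \<delta> by (intro mult_strict_left_mono)
      then show ?thesis by (simp add: t_def field_simps)
    qed
    have "\<bar>f (x + t *\<^sub>R a + t *\<^sub>R b) - f (x + t *\<^sub>R a) - f (x + t *\<^sub>R b) + f x - t\<^sup>2 * A b\<bar>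
        \<le> 2 * \<epsilon> * t\<^sup>2 * (norm a + norm b)"
      using \<open>\<epsilon> > 0\<close> tc c_def
      by (intro second_difference_estimate[OF \<delta> in_S eA has_derivative_linear[OF A] _ t]) auto
    moreover have "\<bar>f (x + t *\<^sub>R b + t *\<^sub>R a) - f (x + t *\<^sub>R b) - f (x + t *\<^sub>R a) + f x - t\<^sup>2 * B a\<bar>
        \<le> 2 * \<epsilon> * t\<^sup>2 * (norm b + norm a)"
      using \<open>\<epsilon> > 0\<close> tc c_def
      by (intro second_difference_estimate[OF \<delta> in_S eB has_derivative_linear[OF B] _ t]) (auto simp: add.commute)
    moreover have "f (x + t *\<^sub>R b + t *\<^sub>R a) = f (x + t *\<^sub>R a + t *\<^sub>R b)"
      by (simp add: algebra_simps)
    ultimately have "\<bar>t\<^sup>2 * A b - t\<^sup>2 * B a\<bar> \<le> 4 * \<epsilon> * t\<^sup>2 * c"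
      unfolding c_def by (simp add: algebra_simps)
    moreover have "\<bar>t\<^sup>2 * A b - t\<^sup>2 * B a\<bar> = t\<^sup>2 * \<bar>A b - B a\<bar>"
      by (simp add: abs_mult flip: right_diff_distrib)
    ultimately have "t\<^sup>2 * \<bar>A b - B a\<bar> \<le> t\<^sup>2 * (\<epsilon> * (4 * c))"
      by (simp add: mult_ac)
    then show ?thesis using t by simp
  qed
  note bound = this
  have "\<bar>A b - B a\<bar> \<le> 0 + e" if "e > 0" for e
  proof -
    have c: "4 * c + 1 > 0" by (simp add: c_def add_nonneg_pos)
    have "\<bar>A b - B a\<bar> \<le> e / (4 * c + 1) * (4 * c)"
      using that c by (intro bound) simp
    also have "\<dots> \<le> e" using that c by (simp add: field_simps)
    finally show ?thesis by simp
  qed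
  then have "\<bar>A b - B a\<bar> \<le> 0" by (rule field_le_epsilon)
  then show ?thesis by simp
qed

lemma symmetric_second_derivative:
  fixes f :: "'a::real_normed_vector \<Rightarrow> 'b::real_inner"
  assumes "open S" "x \<in> S" and f: "\<And>y. y \<in> S \<Longrightarrow> (f has_derivative f' y) (at y)"
    and A: "((\<lambda>y. f' y a) has_derivative A) (at x)"
    and B: "((\<lambda>y. f' y b) has_derivative B) (at x)"
  shows "A b = B a"
proof -
  have "A b \<bullet> w = B a \<bullet> w" for w
    by (rule symmetric_second_derivative_real[OF assms(1,2), of "\<lambda>y. f y \<bullet> w" "\<lambda>y h. f' y h \<bullet> w"])
      (use f A B in \<open>auto intro!: has_derivative_inner_left\<close>)
  then show ?thesis using vector_eq_rdot by blast
qed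

lemma has_derivative_sgn:
  fixes v :: "'a::real_inner"
  assumes "v \<noteq> 0"
  shows "(sgn has_derivative (\<lambda>h. inverse (norm v) *\<^sub>R (h - (h \<bullet> sgn v) *\<^sub>R sgn v))) (at v)"
proof -
  have "((\<lambda>v. inverse (norm v) *\<^sub>R v) has_derivative
     (\<lambda>h. inverse (norm v) *\<^sub>R h + (- (inverse (norm v) * (h \<bullet> sgn v) * inverse (norm v))) *\<^sub>R v)) (at v)"
    using assms by (auto intro!: derivative_eq_intros has_derivative_norm Deriv.has_derivative_inverse)
  moreover have "(\<lambda>v::'a. inverse (norm v) *\<^sub>R v) = sgn"
    by (simp add: sgn_div_norm fun_eq_iff)
  moreover have "inverse (norm v) *\<^sub>R h + (- (inverse (norm v) * (h \<bullet> sgn v) * inverse (norm v))) *\<^sub>R v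
      = inverse (norm v) *\<^sub>R (h - (h \<bullet> sgn v) *\<^sub>R sgn v)" for h
    by (simp add: sgn_div_norm scaleR_diff_right mult_ac)
  ultimately show ?thesis by simp
qed

text \<open>
  Turns the derivative along the curves \<open>sgn (x + t X)\<close> into an ordinary directional
  derivative of any function \<open>g\<close> on the ambient space that agrees with
  \<open>f\<close> on the sphere near \<open>x\<close>.
\<close>

lemma sphere_deriv_transform:
  fixes f g :: "'a::real_inner \<Rightarrow> 'b::real_normed_vector"
  assumes U: "openin (top_of_set (sphere 0 1)) U" "x \<in> U"
    and fg: "\<And>y. y \<in> U \<Longrightarrow> f y = g y" and g: "(g has_derivative D) (at x)" and X: "X \<bullet> x = 0"
  shows "sphere_deriv f x X = D X"
proof -
  obtain O' where O': "open O'" "U = sphere 0 1 \<inter> O'"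
    using U(1) by (auto simp: openin_open)
  have x: "norm x = 1" "x \<in> O'" "x \<noteq> 0" "sgn x = x" using U(2) O' by (auto simp: sgn_div_norm)
  have inner1: "((\<lambda>t. x + t *\<^sub>R X) has_derivative (\<lambda>t. t *\<^sub>R X)) (at 0)"
    by (auto intro!: derivative_eq_intros)
  have "(sgn has_derivative (\<lambda>h. h - (h \<bullet> x) *\<^sub>R x)) (at x)"
    using has_derivative_sgn[OF x(3)] x by simp
  then have "(sgn has_derivative (\<lambda>h. h - (h \<bullet> x) *\<^sub>R x)) (at (x + 0 *\<^sub>R X))" by simp
  from has_derivative_compose[OF inner1 this]
  have c: "((\<lambda>t. sgn (x + t *\<^sub>R X)) has_derivative (\<lambda>t. t *\<^sub>R X)) (at 0)"
    using X by simp
  have "(g has_derivative D) (at (sgn (x + 0 *\<^sub>R X)))" using g x by simp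
  from has_derivative_compose[OF c this]
  have gd: "((\<lambda>t. g (sgn (x + t *\<^sub>R X))) has_derivative (\<lambda>t. D (t *\<^sub>R X))) (at 0)" .
  have "continuous (at 0) (\<lambda>t. sgn (x + t *\<^sub>R X))" by (rule has_derivative_continuous[OF c])
  then have lim: "((\<lambda>t. sgn (x + t *\<^sub>R X)) \<longlongrightarrow> x) (at 0)" using x by (simp add: continuous_at)
  have ev1: "\<forall>\<^sub>F t in at 0. sgn (x + t *\<^sub>R X) \<in> O'"
    using topological_tendstoD[OF lim O'(1) x(2)] .
  have ev: "\<forall>\<^sub>F t in at 0. g (sgn (x + t *\<^sub>R X)) = f (sgn (x + t *\<^sub>R X))"
    using ev1
  proof eventually_elim
    case (elim t)
    have "(x + t *\<^sub>R X) \<bullet> x = 1" using x X by (simp add: inner_add_left norm_eq_1)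
    then have "norm (sgn (x + t *\<^sub>R X)) = 1" by (auto simp: norm_sgn)
    then show ?case using elim O' fg by simp
  qed
  have "((\<lambda>t. f (sgn (x + t *\<^sub>R X))) has_derivative (\<lambda>t. D (t *\<^sub>R X))) (at 0)"
    by (rule has_derivative_transform_eventually[OF gd ev]) (use x U fg in auto)
  then have "((\<lambda>t. f (sgn (x + t *\<^sub>R X))) has_vector_derivative D X) (at 0)"
    unfolding has_vector_derivative_def
    using linear_scale[OF has_derivative_linear[OF g]] by simp
  then show ?thesis unfolding sphere_deriv_def by (rule vector_derivative_at)
qed

section \<open>Orthonormal eigenbases of symmetric endomorphisms\<close>

text \<open>
  A maximum of the quadratic form \<open>x \<bullet> A x\<close> on the unit sphere of
  \<open>S\<close> is an eigenvector, since the form \<open>\<theta> |v|\<^sup>2 - v \<bullet> A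
  v\<close> is nonnegative on \<open>S\<close> and vanishes there, so that its first variation
  vanishes.
\<close>

lemma symmetric_eigenvector:
  fixes A :: "'a::euclidean_space \<Rightarrow> 'a"
  assumes "linear A" and sym: "\<And>x y. A x \<bullet> y = x \<bullet> A y"
    and "subspace S" "S \<noteq> {0}" and inv: "\<And>x. x \<in> S \<Longrightarrow> A x \<in> S"
  obtains x \<theta> where "x \<in> S" "norm x = 1" "A x = \<theta> *\<^sub>R x"
proof -
  let ?K = "S \<inter> sphere 0 1"
  have "compact ?K"
    using closed_subspace[OF assms(3)] by (simp add: closed_Int_compact)
  moreover have "?K \<noteq> {}"
  proof -
    obtain y where "y \<in> S" "y \<noteq> 0"
      using assms(3,4) subspace_0 by blast
    then have "sgn y \<in> ?K"
      using assms(3) by (simp add: sgn_div_norm subspace_scale)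
    then show ?thesis by blast
  qed
  moreover have "continuous_on ?K (\<lambda>x. x \<bullet> A x)"
    using \<open>linear A\<close> by (intro continuous_intros linear_continuous_on) (simp add: linear_conv_bounded_linear)
  ultimately obtain x where x: "x \<in> ?K" and max: "\<And>y. y \<in> ?K \<Longrightarrow> y \<bullet> A y \<le> x \<bullet> A x"
    using continuous_attains_sup[of ?K "\<lambda>x. x \<bullet> A x"] by metis
  define \<theta> where "\<theta> = x \<bullet> A x"
  have quad: "v \<bullet> A v \<le> \<theta> * (v \<bullet> v)" if "v \<in> S" for v
  proof (cases "v = 0")
    case False
    have "sgn v \<in> ?K"
      using that False assms(3) by (simp add: sgn_div_norm subspace_scale)
    from max[OF this] have "(v \<bullet> A v) / (norm v)\<^sup>2 \<le> \<theta>"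
      using \<open>linear A\<close> by (simp add: sgn_div_norm linear_scale \<theta>_def power2_eq_square divide_inverse mult_ac)
    then show ?thesis using False by (simp add: divide_simps power2_norm_eq_inner)
  qed (use linear_0[OF \<open>linear A\<close>] in simp)
  define w where "w = \<theta> *\<^sub>R x - A x"
  define \<gamma> where "\<gamma> = \<theta> * (w \<bullet> w) - w \<bullet> A w"
  have "w \<in> S" using x assms by (simp add: w_def subspace_diff subspace_scale)
  then have \<gamma>: "\<gamma> \<ge> 0" using quad by (simp add: \<gamma>_def)
  have xx: "x \<bullet> x = 1" using x by (simp add: norm_eq_1)
  \<comment> \<open>first variation in the direction of the defect\<close>
  \<comment> \<open>evaluate \<open>\<theta> |v|\<^sup>2 - v \<bullet> A v \<ge> 0\<close> at \<open>v = x - t w\<close>; the linear term in \<open>t\<close> is \<open>- 2 t |w|\<^sup>2\<close>\<close>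
  have var: "2 * t * (w \<bullet> w) \<le> t\<^sup>2 * \<gamma>" for t
  proof -
    have "x - t *\<^sub>R w \<in> S" using x \<open>w \<in> S\<close> assms(3) by (simp add: subspace_diff subspace_scale)
    note q = quad[OF this]
    have Aw: "A (x - t *\<^sub>R w) = A x - t *\<^sub>R A w"
      using \<open>linear A\<close> by (simp add: linear_diff linear_scale)
    have wx: "w \<bullet> A x = x \<bullet> A w" by (metis sym inner_commute)
    have ww: "w \<bullet> w = \<theta> * (x \<bullet> w) - x \<bullet> A w"
      by (subst (1) w_def) (simp add: inner_diff_left sym)
    have "(x - t *\<^sub>R w) \<bullet> A (x - t *\<^sub>R w) = \<theta> - 2 * t * (x \<bullet> A w) + t\<^sup>2 * (w \<bullet> A w)"
      unfolding Aw by (simp add: inner_diff_left inner_diff_right wx \<theta>_def power2_eq_square algebra_simps)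
    moreover have "(x - t *\<^sub>R w) \<bullet> (x - t *\<^sub>R w) = 1 - 2 * t * (x \<bullet> w) + t\<^sup>2 * (w \<bullet> w)"
      by (simp add: inner_diff_left inner_diff_right xx inner_commute[of w x] power2_eq_square algebra_simps)
    ultimately have "\<theta> - 2 * t * (x \<bullet> A w) + t\<^sup>2 * (w \<bullet> A w)
        \<le> \<theta> * (1 - 2 * t * (x \<bullet> w) + t\<^sup>2 * (w \<bullet> w))"
      using q by (simp only:)
    then have "2 * t * (\<theta> * (x \<bullet> w) - x \<bullet> A w) \<le> t\<^sup>2 * \<gamma>"
      by (simp add: \<gamma>_def algebra_simps)
    then show ?thesis by (simp only: ww)
  qed
  have "w \<bullet> w = 0"
  proof (rule ccontr)
    assume "w \<bullet> w \<noteq> 0"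
    then have pos: "w \<bullet> w > 0" by simp
    \<comment> \<open>so small that the linear term beats the quadratic one; the summand \<open>1\<close> covers \<open>\<gamma> = 0\<close>\<close>
    define t where "t = (w \<bullet> w) / (\<gamma> + 1)"
    have t: "t > 0" using pos \<gamma> by (simp add: t_def)
    have "t * (2 * (w \<bullet> w)) \<le> t * (t * \<gamma>)" using var[of t] by (simp add: power2_eq_square mult_ac)
    then have "2 * (w \<bullet> w) \<le> t * \<gamma>" using t by simp
    also have "t * \<gamma> \<le> w \<bullet> w" using pos \<gamma> by (simp add: t_def field_simps)
    finally show False using pos by simp
  qed
  then have "A x = \<theta> *\<^sub>R x" by (simp add: w_def)
  then show ?thesis using x by (intro that[of x \<theta>]) auto
qed

text \<open>
  Split off one eigenvector and continue in its orthogonal complement within \<open>S\<close>,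
  which is again invariant by symmetry.
\<close>

lemma symmetric_orthonormal_eigenbasis_subspace:
  fixes A :: "'a::euclidean_space \<Rightarrow> 'a"
  assumes "linear A" and sym: "\<And>x y. A x \<bullet> y = x \<bullet> A y"
    and "subspace S" and inv: "\<And>x. x \<in> S \<Longrightarrow> A x \<in> S"
  shows "\<exists>B\<subseteq>S. pairwise orthogonal B \<and> S \<subseteq> span B \<and>
    (\<forall>b\<in>B. norm b = 1 \<and> (\<exists>\<theta>. A b = \<theta> *\<^sub>R b))"
  using assms(3,4)
proof (induction "dim S" arbitrary: S rule: less_induct)
  case less
  show ?case
  proof (cases "S = {0}")
    case True
    then show ?thesis by (intro exI[of _ "{}"]) auto
  next
    case False
    obtain x \<theta> where x: "x \<in> S" "norm x = 1" "A x = \<theta> *\<^sub>R x"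
      using symmetric_eigenvector[OF assms(1,2) less.prems(1) False less.prems(2)] .
    define S' where "S' = S \<inter> {y. x \<bullet> y = 0}"
    have sub': "subspace S'"
      unfolding S'_def by (intro subspace_inter less.prems(1) subspace_hyperplane)
    have "x \<notin> S'" using x by (auto simp: S'_def)
    then have "S' \<subset> S" using x(1) unfolding S'_def by blast
    then have "dim S' < dim S"
      using sub' less.prems(1) by (metis dim_psubset span_eq_iff)
    moreover have "A y \<in> S'" if "y \<in> S'" for y
    proof -
      have "x \<bullet> A y = \<theta> * (x \<bullet> y)" using x(3) by (metis sym inner_scaleR_left)
      then show ?thesis using that less.prems(2) by (simp add: S'_def)
    qed
    ultimately obtain B where B: "B \<subseteq> S'" "pairwise orthogonal B" "S' \<subseteq> span B"
      "\<forall>b\<in>B. norm b = 1 \<and> (\<exists>\<theta>. A b = \<theta> *\<^sub>R b)"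
      using less.hyps sub' by blast
    have "y \<in> span (insert x B)" if "y \<in> S" for y
    proof -
      have "y - (x \<bullet> y) *\<^sub>R x \<in> S'"
        using that x less.prems(1)
        by (simp add: S'_def subspace_diff subspace_scale inner_diff_right norm_eq_1)
      then have "y - (x \<bullet> y) *\<^sub>R x \<in> span B" using B(3) by blast
      then show ?thesis by (auto simp: span_insert)
    qed
    moreover have "pairwise orthogonal (insert x B)"
      using B(1,2) by (auto simp: pairwise_insert S'_def orthogonal_def inner_commute)
    ultimately show ?thesis
      using B x by (intro exI[of _ "insert x B"]) (auto simp: S'_def)
  qed
qed

lemma symmetric_orthonormal_eigenbasis:
  fixes A :: "'a::euclidean_space \<Rightarrow> 'a"
  assumes "linear A" "\<And>x y. A x \<bullet> y = x \<bullet> A y"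
  obtains B where "pairwise orthogonal B" "span B = UNIV" "finite B" "card B = DIM('a)"
    "\<And>b. b \<in> B \<Longrightarrow> norm b = 1" "\<And>b. b \<in> B \<Longrightarrow> \<exists>\<theta>. A b = \<theta> *\<^sub>R b"
proof -
  obtain B where B: "pairwise orthogonal B" "UNIV \<subseteq> span B"
    "\<forall>b\<in>B. norm b = 1 \<and> (\<exists>\<theta>. A b = \<theta> *\<^sub>R b)"
    using symmetric_orthonormal_eigenbasis_subspace[OF assms subspace_UNIV] by auto
  have "0 \<notin> B" using B(3) by force
  then have ind: "independent B" using B(1) by (simp add: pairwise_orthogonal_independent)
  moreover have "finite B" using ind by (rule independent_imp_finite)
  moreover have "card B = DIM('a)"
    using ind B(2) by (metis dim_UNIV dim_eq_card_independent dim_span top.extremum_unique)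
  ultimately show ?thesis using B by (intro that[of B]) auto
qed

section \<open>Clifford multiplication and the volume element\<close>

locale skew_clifford_module =
  fixes cl :: "real ^ 'n::finite \<Rightarrow> 's::euclidean_space \<Rightarrow> 's"
  assumes bilin: "bilinear cl"
    and clifford: "cl v (cl w \<phi>) + cl w (cl v \<phi>) = (- 2 * (v \<bullet> w)) *\<^sub>R \<phi>"
    and skew: "cl v \<phi> \<bullet> \<psi> = - (\<phi> \<bullet> cl v \<psi>)"

lemma real_spin_module_skew_clifford:
  "real_spin_module cl \<Longrightarrow> skew_clifford_module cl"
  unfolding real_spin_module_def clifford_module_def skew_clifford_module_def by (elim conjE) (intro conjI; assumption)

context skew_clifford_module
begin

lemma linear_cl: "linear (cl v)" and linear_cl_vector: "linear (\<lambda>v. cl v \<phi>)"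
  using bilin by (auto simp: bilinear_def)

lemmas cl_simps = linear_add[OF linear_cl] linear_diff[OF linear_cl] linear_scale[OF linear_cl]
  linear_0[OF linear_cl] linear_neg[OF linear_cl]
  linear_add[OF linear_cl_vector] linear_diff[OF linear_cl_vector] linear_scale[OF linear_cl_vector]
  linear_0[OF linear_cl_vector] linear_neg[OF linear_cl_vector]

lemma bounded_bilinear_cl: "bounded_bilinear cl"
  using bilin by (simp add: bilinear_conv_bounded_bilinear)

lemma cl_swap: "cl v (cl w \<phi>) = - cl w (cl v \<phi>) - (2 * (v \<bullet> w)) *\<^sub>R \<phi>"
  using clifford[of v w \<phi>] by (simp add: algebra_simps eq_neg_iff_add_eq_0)

lemma cl_anticommute: "v \<bullet> w = 0 \<Longrightarrow> cl v (cl w \<phi>) = - cl w (cl v \<phi>)"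
  using cl_swap[of v w] by simp

lemma cl_square: "cl v (cl v \<phi>) = - (v \<bullet> v) *\<^sub>R \<phi>"
proof -
  have "cl v (cl v \<phi>) = (1/2) *\<^sub>R (cl v (cl v \<phi>) + cl v (cl v \<phi>))"
    by (simp flip: scaleR_2)
  also have "\<dots> = - (v \<bullet> v) *\<^sub>R \<phi>" unfolding clifford by simp
  finally show ?thesis .
qed

lemma cl_self_inner: "cl v \<phi> \<bullet> \<phi> = 0"
  using skew[of v \<phi> \<phi>] by (simp add: inner_commute)

lemma cl_inner_cl: "cl v \<phi> \<bullet> cl w \<phi> = (v \<bullet> w) * (\<phi> \<bullet> \<phi>)"
proof -
  have "cl v \<phi> \<bullet> cl w \<phi> = - (\<phi> \<bullet> cl v (cl w \<phi>))" by (rule skew)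
  also have "\<dots> = \<phi> \<bullet> cl w (cl v \<phi>) + 2 * (v \<bullet> w) * (\<phi> \<bullet> \<phi>)"
    by (subst cl_swap) (simp add: inner_diff_right)
  also have "\<phi> \<bullet> cl w (cl v \<phi>) = - (cl v \<phi> \<bullet> cl w \<phi>)"
    using skew[of w \<phi> "cl v \<phi>"] by (simp add: inner_commute)
  finally show ?thesis by simp
qed

lemma cl_eq_0_iff: "cl v \<phi> = 0 \<longleftrightarrow> v = 0 \<or> \<phi> = 0"
  using cl_inner_cl[of v \<phi> v] by (auto simp: cl_simps)

lemma cl_expand: "cl v \<phi> = (\<Sum>i\<in>UNIV. (v $ i) *\<^sub>R cl (axis i 1) \<phi>)"
proof -
  have "v = (\<Sum>i\<in>UNIV. (v $ i) *\<^sub>R axis i 1)"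
    using basis_expansion[of v] by (simp add: scalar_mult_eq_scaleR)
  then have "cl v \<phi> = cl (\<Sum>i\<in>UNIV. (v $ i) *\<^sub>R axis i 1) \<phi>" by simp
  then show ?thesis by (simp add: linear_sum[OF linear_cl_vector] cl_simps)
qed

lemma cl_cl_expand:
  "cl v (cl w \<phi>) = (\<Sum>i\<in>UNIV. \<Sum>j\<in>UNIV. (v $ i * w $ j) *\<^sub>R cl (axis i 1) (cl (axis j 1) \<phi>))"
proof -
  have "cl (axis i 1) (cl w \<phi>) = (\<Sum>j\<in>UNIV. (w $ j) *\<^sub>R cl (axis i 1) (cl (axis j 1) \<phi>))" for i
    by (subst cl_expand[of w]) (simp add: linear_sum[OF linear_cl] cl_simps)
  then show ?thesis by (subst cl_expand) (simp add: scaleR_sum_right)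
qed

lemma linear_cl_prod: "linear (cl_prod cl vs)"
proof (induction vs)
  case Nil
  then show ?case by (simp add: cl_prod_def linear_id[unfolded id_def])
next
  case (Cons v vs)
  then show ?case using linear_compose[OF Cons linear_cl[of v]] by (simp add: cl_prod_def o_def)
qed

lemma linear_volume_element: "linear (volume_element cl es)"
  by (simp add: volume_element_def linear_cl_prod)

text \<open>
  Moving \<open>e\<^sub>i\<close> through the product costs one sign for each factor different
  from \<open>e\<^sub>i\<close>.
\<close>

lemma cl_axis_volume_element:
  "cl (axis i 1) (volume_element cl es \<phi>) =
    (- 1) ^ length (filter (\<lambda>j. j \<noteq> i) es) *\<^sub>R volume_element cl es (cl (axis i 1) \<phi>)"
proof (induction es)
  case Nil
  then show ?case by (simp add: volume_element_def cl_prod_def)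
next
  case (Cons j es)
  have step: "volume_element cl (j # es) \<psi> = cl (axis j 1) (volume_element cl es \<psi>)" for \<psi>
    by (simp add: volume_element_def cl_prod_def)
  show ?case
  proof (cases "j = i")
    case True
    then show ?thesis using Cons step[unfolded True] by (simp add: cl_simps)
  next
    case False
    then have "axis i 1 \<bullet> (axis j 1 :: real ^ 'n) = 0" by (simp add: inner_axis_axis)
    then show ?thesis using Cons False by (simp add: step cl_simps cl_anticommute)
  qed
qed

text \<open>
  In even dimension the number of factors different from a given \<open>e\<^sub>i\<close> is odd.
  Hence Clifford multiplication by vectors exchanges the two eigenspaces of the volume element.
\<close>

lemma volume_element_anticommute:
  assumes "distinct es" "set es = UNIV" "even CARD('n)"
  shows "volume_element cl es (cl v \<phi>) = - cl v (volume_element cl es \<phi>)"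
proof -
  have len: "odd (length (filter (\<lambda>j. j \<noteq> i) es))" for i
  proof -
    have "length (filter (\<lambda>j. j \<noteq> i) es) = card (UNIV - {i})"
      using distinct_card[OF distinct_filter[OF assms(1)], of "\<lambda>j. j \<noteq> i"] assms(2)
      by (simp add: Compl_eq_Diff_UNIV Collect_neg_eq[symmetric] set_diff_eq)
    moreover have "card (UNIV - {i}) = CARD('n) - 1" by simp
    ultimately show ?thesis using assms(3) by simp
  qed
  have ax: "volume_element cl es (cl (axis i 1) \<phi>) = - cl (axis i 1) (volume_element cl es \<phi>)" for i
    using cl_axis_volume_element[of i es \<phi>] len[of i] by simp
  have "linear (\<lambda>v. volume_element cl es (cl v \<phi>))"
    using linear_compose[OF linear_cl_vector linear_volume_element] by (simp add: o_def)
  moreover have "linear (\<lambda>v. - cl v (volume_element cl es \<phi>))"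
    by (intro linear_compose_neg linear_cl_vector)
  ultimately have "(\<lambda>v. volume_element cl es (cl v \<phi>)) = (\<lambda>v. - cl v (volume_element cl es \<phi>))"
    by (rule linear_eq_stdbasis) (auto simp: Basis_vec_def ax)
  then show ?thesis by meson
qed

end

section \<open>Algebraic consequences of the curvature identity\<close>

text \<open>
  The hypotheses on \<open>T\<close> are the two half-spinor components of the curvature identity
  for a pair of orthonormal eigenvectors, \<open>p\<close> and \<open>m\<close> being the
  components of the spinor.  Taking the scalar product of the second one with \<open>e1 \<cdot>
  m\<close> and of the first one with \<open>e1 \<cdot> p\<close> gives \<open>g(T, e1)
  |m|\<^sup>2\<close> and \<open>g(T, e1) |p|\<^sup>2\<close> as values of opposite sign, because
  Clifford multiplication by \<open>e2\<close> is skew.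
\<close>

lemma eigenpair_relation:
  fixes cl :: "real ^ 'n::finite \<Rightarrow> 's::euclidean_space \<Rightarrow> 's"
  assumes "skew_clifford_module cl"
    and e: "norm e1 = 1" "e1 \<bullet> e2 = 0"
    and T: "cl T p = \<kappa> *\<^sub>R cl e1 (cl e2 m)" "cl T m = \<kappa> *\<^sub>R cl e1 (cl e2 p)"
    and "p \<noteq> 0"
  shows "T \<bullet> e1 = 0" "\<kappa> * (cl e2 p \<bullet> m) = 0"
proof -
  interpret skew_clifford_module cl by fact
  have e1: "e1 \<bullet> e1 = 1" using e by (simp add: norm_eq_1)
  have key: "cl e1 (cl e2 \<phi>) \<bullet> cl e1 \<psi> = cl e2 \<phi> \<bullet> \<psi>" for \<phi> \<psi>
    using skew[of e1 "cl e2 \<phi>" "cl e1 \<psi>"] by (simp add: cl_square e1)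
  have m: "(T \<bullet> e1) * (m \<bullet> m) = \<kappa> * (cl e2 p \<bullet> m)"
    using cl_inner_cl[of T m e1] by (simp add: T key)
  have p: "(T \<bullet> e1) * (p \<bullet> p) = - (\<kappa> * (cl e2 p \<bullet> m))"
    using cl_inner_cl[of T p e1] skew[of e2 m p] unfolding T(1) by (simp add: key inner_commute[of m])
  have "(T \<bullet> e1) * (p \<bullet> p + m \<bullet> m) = 0" using m p by (simp add: distrib_left)
  moreover have "p \<bullet> p + m \<bullet> m > 0" using \<open>p \<noteq> 0\<close> by (simp add: add_pos_nonneg)
  ultimately show "T \<bullet> e1 = 0" by simp
  then show "\<kappa> * (cl e2 p \<bullet> m) = 0" using m by simp
qed

text \<open>
  By \<open>eigenpair_relation\<close>, \<open>T\<close> is orthogonal to \<open>e1\<close> and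
  \<open>e2\<close> and therefore anticommutes with both.  Moving these three factors across the
  scalar product shows \<open>|T|\<^sup>2 |m|\<^sup>2 = |T|\<^sup>2 |p|\<^sup>2\<close>, so
  \<open>T = 0\<close> and the product \<open>\<kappa> e1 \<cdot> e2 \<cdot> p\<close> vanishes.
\<close>

lemma eigenpair_vanishing:
  fixes cl :: "real ^ 'n::finite \<Rightarrow> 's::euclidean_space \<Rightarrow> 's"
  assumes "skew_clifford_module cl"
    and e: "norm e1 = 1" "norm e2 = 1" "e1 \<bullet> e2 = 0"
    and T: "cl T p = \<kappa> *\<^sub>R cl e1 (cl e2 m)" "cl T m = \<kappa> *\<^sub>R cl e1 (cl e2 p)"
    and "p \<noteq> 0" and f: "p \<bullet> p \<noteq> m \<bullet> m"
  shows "\<kappa> = 0"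
proof -
  interpret skew_clifford_module cl by fact
  have T1: "T \<bullet> e1 = 0" by (rule eigenpair_relation[OF assms(1) e(1,3) T assms(7)])
  have T2: "T \<bullet> e2 = 0"
    \<comment> \<open>exchange \<open>e1\<close> and \<open>e2\<close>, which anticommute; this changes the sign of \<open>\<kappa>\<close>\<close>
    by (rule eigenpair_relation[OF assms(1) e(2), of e1 T p "- \<kappa>" m])
      (use e T assms(7) in \<open>auto simp: inner_commute cl_anticommute[of e1 e2]\<close>)
  have "(T \<bullet> T) * (m \<bullet> m) = \<kappa> * (cl e1 (cl e2 p) \<bullet> cl T m)"
    using cl_inner_cl[of T m T] by (simp add: T(2))
  also have "cl e1 (cl e2 p) \<bullet> cl T m = p \<bullet> cl e2 (cl e1 (cl T m))"
    by (simp add: skew)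
  also have "cl e2 (cl e1 (cl T m)) = cl T (cl e2 (cl e1 m))"
    using T1 T2 by (simp add: cl_anticommute[of _ T] inner_commute cl_simps)
  also have "p \<bullet> cl T (cl e2 (cl e1 m)) = cl T p \<bullet> cl e1 (cl e2 m)"
    using e(3) by (simp add: skew cl_anticommute[of e1 e2])
  also have "\<kappa> * (cl T p \<bullet> cl e1 (cl e2 m)) = (T \<bullet> T) * (p \<bullet> p)"
    using cl_inner_cl[of T p T] by (simp add: T(1) inner_commute)
  finally have "(T \<bullet> T) * (p \<bullet> p - m \<bullet> m) = 0" by auto
  then have "T = 0" using f inner_eq_zero_iff mult_eq_0_iff right_minus_eq by metis
  then have "\<kappa> *\<^sub>R cl e1 (cl e2 p) = 0" using T(2) by (simp add: cl_simps)
  moreover have "e1 \<noteq> 0" "e2 \<noteq> 0" using e by auto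
  ultimately show ?thesis using \<open>p \<noteq> 0\<close> by (auto simp: cl_eq_0_iff)
qed

text \<open>
  Applying \<open>vol\<close> to the identity for \<open>p + m\<close> changes the sign of one
  component on each side, so adding and subtracting separates the two components.
\<close>

lemma curvature_on_eigenpair:
  fixes cl :: "real ^ 'n::finite \<Rightarrow> 's::euclidean_space \<Rightarrow> 's"
  assumes "skew_clifford_module cl"
    and curv: "\<And>X Y. \<exists>T. cl T (p + m) = cl (A X) (cl (A Y) (p + m)) - cl (A Y) (cl (A X) (p + m))
        - (1/4) *\<^sub>R (cl X (cl Y (p + m)) - cl Y (cl X (p + m)))"
    and vol: "linear vol" "\<And>v \<phi>. vol (cl v \<phi>) = - cl v (vol \<phi>)" "vol p = p" "vol m = - m"
    and e: "e1 \<bullet> e2 = 0" "A e1 = \<theta> *\<^sub>R e1" "A e2 = \<mu> *\<^sub>R e2"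
  obtains T where "cl T p = (2 * (\<theta> * \<mu> - 1/4)) *\<^sub>R cl e1 (cl e2 m)"
    "cl T m = (2 * (\<theta> * \<mu> - 1/4)) *\<^sub>R cl e1 (cl e2 p)"
proof -
  interpret skew_clifford_module cl by fact
  define \<kappa> where "\<kappa> = 2 * (\<theta> * \<mu> - 1/4)"
  obtain T where T: "cl T (p + m) = cl (A e1) (cl (A e2) (p + m)) - cl (A e2) (cl (A e1) (p + m))
        - (1/4) *\<^sub>R (cl e1 (cl e2 (p + m)) - cl e2 (cl e1 (p + m)))" using curv by blast
  have sw: "cl e2 (cl e1 \<phi>) = - cl e1 (cl e2 \<phi>)" for \<phi>
    using e(1) by (simp add: cl_anticommute[of e1 e2])
  have "cl T (p + m) = \<kappa> *\<^sub>R cl e1 (cl e2 (p + m))"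
    unfolding T e(2,3) \<kappa>_def by (simp add: cl_simps(3,8) sw algebra_simps flip: scaleR_add_left)
  then have 1: "cl T p + cl T m = \<kappa> *\<^sub>R cl e1 (cl e2 p) + \<kappa> *\<^sub>R cl e1 (cl e2 m)"
    by (simp add: cl_simps scaleR_add_right)
  then have "vol (cl T p + cl T m) = vol (\<kappa> *\<^sub>R cl e1 (cl e2 p) + \<kappa> *\<^sub>R cl e1 (cl e2 m))" by simp
  then have 2: "- cl T p + cl T m = \<kappa> *\<^sub>R cl e1 (cl e2 p) - \<kappa> *\<^sub>R cl e1 (cl e2 m)"
    by (simp add: linear_add[OF vol(1)] linear_scale[OF vol(1)] vol(2-) cl_simps)
  have "cl T m = (1/2) *\<^sub>R ((cl T p + cl T m) + (- cl T p + cl T m))"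
    by (simp flip: scaleR_2)
  also have "\<dots> = (1/2) *\<^sub>R (\<kappa> *\<^sub>R cl e1 (cl e2 p) + \<kappa> *\<^sub>R cl e1 (cl e2 p))"
    unfolding 1 2 by simp
  finally have m: "cl T m = \<kappa> *\<^sub>R cl e1 (cl e2 p)" by (simp flip: scaleR_2)
  then have "cl T p = \<kappa> *\<^sub>R cl e1 (cl e2 m)" using 1 by simp
  with m show ?thesis using that unfolding \<kappa>_def by blast
qed

text \<open>
  Here \<open>A\<close> is the endomorphism in an orthonormal frame and \<open>vol\<close> the
  volume element.  Any two distinct members \<open>e\<close>, \<open>e'\<close> of an orthonormal
  eigenbasis, with eigenvalues \<open>\<lambda>\<close>, \<open>\<mu>\<close>, satisfy
  \<open>(\<lambda> \<mu> - 1/4) g(\<eta>, e') = 0\<close>, and even \<open>\<lambda> \<mu> =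
  1/4\<close> if \<open>p\<close> and \<open>m\<close> have different norms.  The dimension enters
  through the third eigenvector \<open>e''\<close> needed to compare two eigenvalues: both have
  product \<open>1/4\<close> with that of \<open>e''\<close>.
\<close>

lemma curvature_rigidity:
  fixes cl :: "real ^ 'n::finite \<Rightarrow> 's::euclidean_space \<Rightarrow> 's"
  assumes "skew_clifford_module cl" and n: "CARD('n) \<ge> 3"
    and A: "linear A" "\<And>X Y. A X \<bullet> Y = X \<bullet> A Y"
    and curv: "\<And>X Y. \<exists>T. cl T (p + m) = cl (A X) (cl (A Y) (p + m)) - cl (A Y) (cl (A X) (p + m))
        - (1/4) *\<^sub>R (cl X (cl Y (p + m)) - cl Y (cl X (p + m)))"
    and vol: "linear vol" "\<And>v \<phi>. vol (cl v \<phi>) = - cl v (vol \<phi>)" "vol p = p" "vol m = - m"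
    and \<eta>: "\<And>X. \<eta> \<bullet> X = cl X p \<bullet> m" "\<eta> \<noteq> 0"
  shows "A \<eta> \<noteq> 0"
    and "p \<bullet> p \<noteq> m \<bullet> m \<Longrightarrow> \<exists>c. c\<^sup>2 = 1/4 \<and> (\<forall>X. A X = c *\<^sub>R X)"
proof -
  interpret skew_clifford_module cl by fact
  obtain B where B: "pairwise orthogonal B" "span B = UNIV" "finite B" "card B = CARD('n)"
    "\<And>b. b \<in> B \<Longrightarrow> norm b = 1" "\<And>b. b \<in> B \<Longrightarrow> \<exists>\<theta>. A b = \<theta> *\<^sub>R b"
    using symmetric_orthonormal_eigenbasis[OF A] by auto
  then obtain l where l: "\<And>b. b \<in> B \<Longrightarrow> A b = l b *\<^sub>R b" by metis
  have orth: "a \<bullet> b = 0" if "a \<in> B" "b \<in> B" "a \<noteq> b" for a b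
    using B(1) that by (simp add: pairwise_def orthogonal_def)
  have other: "\<exists>c\<in>B. c \<noteq> a \<and> c \<noteq> b" for a b
  proof (rule ccontr)
    assume "\<not> ?thesis"
    then have "B \<subseteq> {a, b}" by blast
    then have "card B \<le> card {a, b}" by (intro card_mono) auto
    also have "\<dots> \<le> 2" by (simp add: card_insert_if)
    finally show False using B(4) n by simp
  qed
  have "p \<noteq> 0" using \<eta> cl_simps(4) by (metis inner_eq_zero_iff inner_zero_left)
  have pair: "(l a * l b - 1/4) * (\<eta> \<bullet> b) = 0" if ab: "a \<in> B" "b \<in> B" "a \<noteq> b" for a b
  proof -
    obtain T where "cl T p = (2 * (l a * l b - 1/4)) *\<^sub>R cl a (cl b m)"
        "cl T m = (2 * (l a * l b - 1/4)) *\<^sub>R cl a (cl b p)"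
      using curvature_on_eigenpair[OF assms(1) curv vol orth[OF ab] l[OF ab(1)] l[OF ab(2)]] .
    from eigenpair_relation(2)[OF assms(1) B(5)[OF ab(1)] orth[OF ab] this \<open>p \<noteq> 0\<close>]
    show ?thesis by (auto simp: \<eta>(1))
  qed
  show "A \<eta> \<noteq> 0"
  proof
    assume "A \<eta> = 0"
    have "\<exists>b\<in>B. \<eta> \<bullet> b \<noteq> 0"
    proof (rule ccontr)
      assume "\<not> ?thesis"
      then have "orthogonal \<eta> x" for x
        using orthogonal_to_span[of x B \<eta>] B(2) by (auto simp: orthogonal_def)
      then show False using \<eta>(2) by (simp add: orthogonal_self[symmetric])
    qed
    then obtain b where b: "b \<in> B" "\<eta> \<bullet> b \<noteq> 0" by blast
    have "l b * (\<eta> \<bullet> b) = A \<eta> \<bullet> b" by (simp add: A(2) l[OF b(1)])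
    then have "l b = 0" using b \<open>A \<eta> = 0\<close> by simp
    moreover obtain a where "a \<in> B" "a \<noteq> b" using other by blast
    ultimately show False using pair[of a b] b by simp
  qed
  assume f: "p \<bullet> p \<noteq> m \<bullet> m"
  have prod: "l a * l b = 1/4" if ab: "a \<in> B" "b \<in> B" "a \<noteq> b" for a b
  proof -
    obtain T where "cl T p = (2 * (l a * l b - 1/4)) *\<^sub>R cl a (cl b m)"
        "cl T m = (2 * (l a * l b - 1/4)) *\<^sub>R cl a (cl b p)"
      using curvature_on_eigenpair[OF assms(1) curv vol orth[OF ab] l[OF ab(1)] l[OF ab(2)]] .
    from eigenpair_vanishing[OF assms(1) B(5)[OF ab(1)] B(5)[OF ab(2)] orth[OF ab] this \<open>p \<noteq> 0\<close> f]
    show ?thesis by simp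
  qed
  have eq: "l a = l b" if ab: "a \<in> B" "b \<in> B" for a b
  proof (cases "a = b")
    case False
    obtain c where c: "c \<in> B" "c \<noteq> a" "c \<noteq> b" using other by blast
    have "l a * l c = l b * l c" "l b * l c \<noteq> 0" using prod[of a c] prod[of b c] ab c by (metis, fastforce)
    then show ?thesis by simp
  qed simp
  obtain b where b: "b \<in> B" using other by blast
  obtain a where a: "a \<in> B" "a \<noteq> b" using other by blast
  have "(l b)\<^sup>2 = 1/4" using prod[OF a(1) b a(2)] eq[OF a(1) b] by (simp add: power2_eq_square)
  moreover have "A X = l b *\<^sub>R X" for X
  proof -
    have "linear (\<lambda>X. l b *\<^sub>R X)" by (intro linear_compose_scale_right linear_ident)
    then show ?thesis
      using linear_eq_on[OF A(1), of "\<lambda>X. l b *\<^sub>R X" X B] B(2) l eq[OF _ b] by auto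
  qed
  ultimately show "\<exists>c. c\<^sup>2 = 1/4 \<and> (\<forall>X. A X = c *\<^sub>R X)" by blast
qed

section \<open>Orthonormal frames carried along great circles\<close>

text \<open>
  The rotation in the plane of the unit vectors \<open>x0\<close> and \<open>x\<close> that moves
  \<open>x0\<close> to \<open>x\<close>, that is, parallel transport along the great circle from
  \<open>x0\<close> to \<open>x\<close>, for \<open>x \<noteq> - x0\<close>.  In this form it is
  visibly a rational function of \<open>x\<close>.
\<close>

definition great_circle_rotation :: "'a::real_inner \<Rightarrow> 'a \<Rightarrow> 'a \<Rightarrow> 'a" where
  "great_circle_rotation x0 x v =
    v + (- (inverse (1 + x0 \<bullet> x) * ((x0 + x) \<bullet> v))) *\<^sub>R (x0 + x) + (2 * (x0 \<bullet> v)) *\<^sub>R x"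

lemma great_circle_rotation_inner:
  assumes "norm x0 = 1" "norm x = 1" "1 + x0 \<bullet> x \<noteq> 0"
  shows "great_circle_rotation x0 x v \<bullet> great_circle_rotation x0 x w = v \<bullet> w"
proof -
  define k where "k = inverse (1 + x0 \<bullet> x)"
  define s where "s = x0 + x"
  define a b where "a = s \<bullet> v" and "b = s \<bullet> w"
  have k: "k * (1 + x0 \<bullet> x) = 1" using assms by (simp add: k_def)
  have xx: "x \<bullet> x = 1" "x0 \<bullet> x0 = 1" using assms by (auto simp: norm_eq_1)
  have s: "s \<bullet> s = 2 * (1 + x0 \<bullet> x)" "s \<bullet> x = 1 + x0 \<bullet> x" "x \<bullet> s = 1 + x0 \<bullet> x"
    by (auto simp: s_def inner_add_left inner_add_right xx inner_commute[of x x0])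
  have ab: "v \<bullet> s = a" "w \<bullet> s = b" "s \<bullet> v = a" "s \<bullet> w = b"
    "x \<bullet> v = a - x0 \<bullet> v" "x \<bullet> w = b - x0 \<bullet> w" "v \<bullet> x = a - x0 \<bullet> v" "w \<bullet> x = b - x0 \<bullet> w"
    by (auto simp: a_def b_def s_def inner_add_left inner_add_right inner_commute)
  have "great_circle_rotation x0 x v \<bullet> great_circle_rotation x0 x w =
     (v + (- (k * a)) *\<^sub>R s + (2 * (x0 \<bullet> v)) *\<^sub>R x) \<bullet> (w + (- (k * b)) *\<^sub>R s + (2 * (x0 \<bullet> w)) *\<^sub>R x)"
    unfolding great_circle_rotation_def k_def s_def a_def b_def by simp
  also have "\<dots> = v \<bullet> w - 2 * (k * a * b) + 2 * (k * (1 + x0 \<bullet> x)) * (k * a * b)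
      - 2 * (k * (1 + x0 \<bullet> x)) * (a * (x0 \<bullet> w) + b * (x0 \<bullet> v))
      + 2 * (x0 \<bullet> w) * (a - x0 \<bullet> v) + 2 * (x0 \<bullet> v) * (b - x0 \<bullet> w) + 4 * (x0 \<bullet> v) * (x0 \<bullet> w)"
    by (simp only: inner_add_left inner_add_right inner_scaleR_left inner_scaleR_right s ab xx) algebra
  also have "\<dots> = v \<bullet> w" unfolding k by (simp add: algebra_simps)
  finally show ?thesis .
qed

lemma great_circle_rotation_base:
  assumes "norm x0 = 1" "1 + x0 \<bullet> x \<noteq> 0"
  shows "great_circle_rotation x0 x x0 = x"
proof -
  have "(x0 + x) \<bullet> x0 = 1 + x0 \<bullet> x" using assms(1) by (simp add: inner_add_left norm_eq_1 inner_commute[of x x0])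
  then have "inverse (1 + x0 \<bullet> x) * ((x0 + x) \<bullet> x0) = 1" using assms(2) by simp
  then show ?thesis using assms(1) by (simp only: great_circle_rotation_def) (simp add: norm_eq_1 scaleR_2)
qed

lemma great_circle_rotation_id:
  assumes "norm x0 = 1"
  shows "great_circle_rotation x0 x0 v = v"
  using assms by (simp add: great_circle_rotation_def norm_eq_1 inner_add_left scaleR_2[symmetric])

lemma Ck_on_great_circle_rotation:
  fixes x0 :: "'a::euclidean_space"
  assumes "open W" "\<And>x. x \<in> W \<Longrightarrow> 1 + x0 \<bullet> x \<noteq> 0"
  shows "Ck_on k W (\<lambda>x. great_circle_rotation x0 x v)"
proof -
  have ident: "Ck_on k W (\<lambda>x. x)" by (intro Ck_on_linear assms bounded_linear_ident)
  have c: "Ck_on k W (\<lambda>x. 1 + x0 \<bullet> x)"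
    by (intro Ck_on_add assms(1) Ck_on_const Ck_on_bilinear[OF bounded_bilinear_inner] ident)
  have "Ck_on k W (\<lambda>x. v + (- 1 * (inverse (1 + x0 \<bullet> x) * ((x0 + x) \<bullet> v))) *\<^sub>R (x0 + x) + (2 * (x0 \<bullet> v)) *\<^sub>R x)"
    by (intro Ck_on_add Ck_on_const ident assms Ck_on_bilinear[OF bounded_bilinear_scaleR]
        Ck_on_bilinear[OF bounded_bilinear_mult] Ck_on_bilinear[OF bounded_bilinear_inner]
        Ck_on_inverse c)
  then show ?thesis by (simp add: great_circle_rotation_def)
qed

lemma great_circle_rotation_has_derivative:
  assumes "1 + x0 \<bullet> x \<noteq> 0" and v: "x0 \<bullet> v = 0"
  shows "((\<lambda>y. great_circle_rotation x0 y v) has_derivative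
    (\<lambda>h. (- (inverse (1 + x0 \<bullet> x) * (h \<bullet> v))
          + inverse (1 + x0 \<bullet> x) * (x0 \<bullet> h) * inverse (1 + x0 \<bullet> x) * (x \<bullet> v)) *\<^sub>R (x0 + x)
        - (inverse (1 + x0 \<bullet> x) * (x \<bullet> v)) *\<^sub>R h)) (at x)"
  unfolding great_circle_rotation_def using assms
  by (auto intro!: derivative_eq_intros Deriv.has_derivative_inverse
      simp: inner_add_left algebra_simps)

text \<open>
  The connection form of the frame carried along great circles: \<open>g(\<nabla>\<^sub>X
  e\<^sub>v, e\<^sub>w)\<close> for the fields obtained from \<open>v\<close> and
  \<open>w\<close>.  It vanishes at \<open>x = x0\<close>, where \<open>v\<close> and
  \<open>w\<close> are orthogonal to \<open>x\<close>.
\<close>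

lemma great_circle_connection:
  assumes "norm x0 = 1" "norm x = 1" "1 + x0 \<bullet> x \<noteq> 0"
    and "x0 \<bullet> v = 0" "x0 \<bullet> w = 0" "X \<bullet> x = 0"
    and D: "((\<lambda>y. great_circle_rotation x0 y v) has_derivative D) (at x)"
  shows "D X \<bullet> great_circle_rotation x0 x w =
    inverse (1 + x0 \<bullet> x) * ((v \<bullet> X) * (w \<bullet> x) - (v \<bullet> x) * (w \<bullet> X))"
proof -
  define k where "k = inverse (1 + x0 \<bullet> x)"
  have k: "k * (1 + x0 \<bullet> x) = 1" using assms by (simp add: k_def)
  have xx: "x \<bullet> x = 1" "x0 \<bullet> x0 = 1" using assms by (auto simp: norm_eq_1)
  have D_eq: "D = (\<lambda>h. (- (k * (h \<bullet> v)) + k * (x0 \<bullet> h) * k * (x \<bullet> v)) *\<^sub>R (x0 + x) - (k * (x \<bullet> v)) *\<^sub>R h)"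
    unfolding k_def
    by (rule has_derivative_unique[OF D great_circle_rotation_has_derivative]) (use assms in auto)
  have R: "great_circle_rotation x0 x w = w + (- (k * (x \<bullet> w))) *\<^sub>R (x0 + x)"
    using assms(5) by (simp add: great_circle_rotation_def k_def inner_add_left)
  have sR: "(x0 + x) \<bullet> great_circle_rotation x0 x w = - (x \<bullet> w)"
  proof -
    have "(x0 + x) \<bullet> great_circle_rotation x0 x w = x \<bullet> w - 2 * (k * (1 + x0 \<bullet> x)) * (x \<bullet> w)"
      unfolding R using assms(5) by (simp add: inner_add_left inner_add_right xx inner_commute[of x x0] algebra_simps)
    then show ?thesis unfolding k by simp
  qed
  have XR: "X \<bullet> great_circle_rotation x0 x w = X \<bullet> w - k * (x \<bullet> w) * (x0 \<bullet> X)"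
    unfolding R inner_add_right inner_scaleR_right using assms(6) by (simp add: inner_commute)
  show ?thesis unfolding k_def[symmetric] D_eq inner_diff_left inner_scaleR_left sR XR
    by (simp add: inner_commute algebra_simps)
qed

lemma frame_orthonormal:
  assumes "orthogonal_matrix Q"
  shows "norm (base_point Q) = 1" "frame_vec Q i \<bullet> base_point Q = 0" "base_point Q \<bullet> frame_vec Q i = 0"
    "frame_vec Q i \<bullet> frame_vec Q j = (if i = j then 1 else 0)"
proof -
  have c: "column a Q \<bullet> column b Q = (if a = b then 1 else 0)" for a b
    using assms unfolding orthogonal_matrix_orthonormal_columns orthogonal_def by (auto simp: norm_eq_1)
  show "norm (base_point Q) = 1" "frame_vec Q i \<bullet> base_point Q = 0" "base_point Q \<bullet> frame_vec Q i = 0"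
    "frame_vec Q i \<bullet> frame_vec Q j = (if i = j then 1 else 0)"
    by (auto simp: base_point_def frame_vec_def c norm_eq_1)
qed

lemma linear_frame_coords: "linear (frame_coords Q)"
  by (rule linearI) (auto simp: frame_coords_def vec_eq_iff inner_add_right)

lemma linear_frame_map: "linear (frame_map Q)"
  by (rule linearI) (auto simp: frame_map_def scaleR_add_left sum.distrib scaleR_sum_right)

lemma frame_coords_frame_map:
  assumes "orthogonal_matrix Q"
  shows "frame_coords Q (frame_map Q v) = v"
  by (simp add: frame_coords_def frame_map_def vec_eq_iff inner_sum_right frame_orthonormal[OF assms]
      if_distrib[of "\<lambda>x. _ * x"] cong: if_cong)

lemma frame_map_tangent:
  assumes "orthogonal_matrix Q"
  shows "frame_map Q v \<bullet> base_point Q = 0"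
  by (simp add: frame_map_def inner_sum_left frame_orthonormal[OF assms])

lemma frame_map_frame_coords:
  assumes "orthogonal_matrix Q" "X \<bullet> base_point Q = 0"
  shows "frame_map Q (frame_coords Q X) = X"
proof -
  have "X = Q *v (transpose Q *v X)"
    using assms(1) by (simp only: orthogonal_matrix_def matrix_vector_mul_assoc matrix_vector_mul_lid)
  also have "\<dots> = (\<Sum>j\<in>UNIV. (column j Q \<bullet> X) *\<^sub>R column j Q)"
  proof -
    have "transpose Q $ j = column j Q" for j by (simp add: transpose_def column_def vec_eq_iff)
    then have "(transpose Q *v X) $ j = column j Q \<bullet> X" for j
      by (simp only: matrix_vector_mul_component)
    then show ?thesis by (simp only: matrix_mult_sum scalar_mult_eq_scaleR)
  qed
  also have "\<dots> = (column None Q \<bullet> X) *\<^sub>R column None Q + (\<Sum>i\<in>UNIV. (column (Some i) Q \<bullet> X) *\<^sub>R column (Some i) Q)"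
    by (simp add: UNIV_option_conv sum.reindex)
  also have "column None Q \<bullet> X = 0" using assms(2) by (simp add: base_point_def inner_commute)
  finally show ?thesis by (simp add: frame_map_def frame_coords_def frame_vec_def)
qed

lemma frame_coords_base_point:
  "orthogonal_matrix Q \<Longrightarrow> frame_coords Q (base_point Q) = 0"
  by (simp add: frame_coords_def vec_eq_iff frame_orthonormal)

lemma frame_coords_inner: "frame_coords Q X \<bullet> v = X \<bullet> frame_map Q v"
proof -
  have "frame_coords Q X \<bullet> v = (\<Sum>i\<in>UNIV. frame_coords Q X $ i * v $ i)"
    by (simp add: inner_vec_def)
  then show ?thesis
    by (simp add: frame_coords_def frame_map_def inner_sum_right inner_commute mult.commute)
qed

definition moving_frame ::
    "real ^ ('n::finite option) ^ ('n option) \<Rightarrow> real ^ ('n option) \<Rightarrow> real ^ ('n option) ^ ('n option)" where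
  "moving_frame Q x = (\<chi> i j. great_circle_rotation (base_point Q) x (column j Q) $ i)"

lemma column_moving_frame:
  "column j (moving_frame Q x) = great_circle_rotation (base_point Q) x (column j Q)"
  by (simp add: column_def moving_frame_def vec_eq_iff)

lemma frame_vec_moving_frame:
  "frame_vec (moving_frame Q x) i = great_circle_rotation (base_point Q) x (frame_vec Q i)"
  by (simp add: frame_vec_def column_moving_frame)

lemma moving_frame_id:
  assumes "orthogonal_matrix Q"
  shows "moving_frame Q (base_point Q) = Q"
  using great_circle_rotation_id[OF frame_orthonormal(1)[OF assms]]
  by (simp add: moving_frame_def vec_eq_iff column_def)

lemma base_point_moving_frame:
  assumes "orthogonal_matrix Q" "1 + base_point Q \<bullet> x \<noteq> 0"
  shows "base_point (moving_frame Q x) = x"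
  using great_circle_rotation_base[OF frame_orthonormal(1)[OF assms(1)] assms(2)]
  by (simp add: base_point_def column_moving_frame)

lemma orthogonal_moving_frame:
  assumes "orthogonal_matrix Q" "norm x = 1" "1 + base_point Q \<bullet> x \<noteq> 0"
  shows "orthogonal_matrix (moving_frame Q x)"
  using assms(1) great_circle_rotation_inner[OF frame_orthonormal(1)[OF assms(1)] assms(2,3)]
  unfolding orthogonal_matrix_orthonormal_columns orthogonal_def column_moving_frame
  by (simp add: norm_eq_1)

lemma Ck_on_moving_frame:
  assumes "open W" "\<And>x. x \<in> W \<Longrightarrow> 1 + base_point Q \<bullet> x \<noteq> 0"
  shows "Ck_on k W (moving_frame Q)"
proof (rule Ck_on_componentwise[OF assms(1)])
  fix b :: "real ^ ('a option) ^ ('a option)" assume "b \<in> Basis"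
  then obtain i j where b: "b = axis i (axis j 1)" by (auto simp: Basis_vec_def)
  have "Ck_on k W (\<lambda>x. great_circle_rotation (base_point Q) x (column j Q) \<bullet> axis i 1)"
    by (intro Ck_on_bilinear[OF bounded_bilinear_inner] assms Ck_on_great_circle_rotation Ck_on_const)
  then show "Ck_on k W (\<lambda>x. moving_frame Q x \<bullet> b)"
    by (simp add: b moving_frame_def inner_axis)
qed

lemma continuous_on_det:
  fixes Q :: "'a::topological_space \<Rightarrow> real ^ 'n ^ 'n"
  assumes "continuous_on S Q"
  shows "continuous_on S (\<lambda>x. det (Q x))"
  unfolding det_def using assms by (intro continuous_intros)

text \<open>
  The covering \<open>F\<close> has a continuous local inverse through \<open>p\<close>, and
  composing it with the moving frame gives the section.  Orthogonality of the moving frame holds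
  wherever it is defined; the restriction to positive determinant makes it a rotation.
\<close>

lemma moving_local_section:
  fixes cl :: "real ^ 'n::finite \<Rightarrow> 's::euclidean_space \<Rightarrow> 's"
    and F :: "'p::topological_space \<Rightarrow> real ^ ('n option) ^ ('n option)"
  assumes "spin_structure cl P F act" "p \<in> P"
  obtains U s where "smooth_local_section P F U s" "base_point (F p) \<in> U" "s (base_point (F p)) = p"
    "\<And>x. x \<in> U \<Longrightarrow> norm x = 1 \<and> 1 + base_point (F p) \<bullet> x > 0 \<and> F (s x) = moving_frame (F p) x"
proof -
  let ?R = "{Q :: real ^ ('n option) ^ ('n option). rotation_matrix Q}"
  define Q where "Q = F p"
  define x0 where "x0 = base_point Q"
  have cov: "covering_space P F ?R" using assms(1) by (simp add: spin_structure_def)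
  have QR: "Q \<in> ?R" using cov assms(2) unfolding covering_space_def Q_def by blast
  then have orth: "orthogonal_matrix Q" "det Q = 1" by (auto simp: rotation_matrix_def)
  have n0: "norm x0 = 1" using frame_orthonormal(1)[OF orth(1)] by (simp add: x0_def)
  obtain T \<V> where T: "Q \<in> T" "openin (top_of_set ?R) T" "\<Union>\<V> = P \<inter> F -` T"
      "\<forall>u\<in>\<V>. \<exists>q. homeomorphism u T F q"
    using cov QR unfolding covering_space_def by metis
  have "p \<in> \<Union>\<V>" using T assms(2) by (simp add: Q_def)
  then obtain u where u: "u \<in> \<V>" "p \<in> u" by blast
  then obtain q where q: "homeomorphism u T F q" using T(4) by blast
  obtain G where G: "open G" "T = ?R \<inter> G" using T(2) by (auto simp: openin_open)
  define W where "W = {x. 1 + x0 \<bullet> x > 0}"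
  have W: "open W" unfolding W_def by (intro open_Collect_less continuous_intros)
  have Ck: "Ck_on k W (moving_frame Q)" for k
    using W by (intro Ck_on_moving_frame) (auto simp: W_def x0_def)
  have cont: "continuous_on W (moving_frame Q)" using Ck[of 0] by simp
  define W' where "W' = (W \<inter> moving_frame Q -` G) \<inter> (W \<inter> (\<lambda>x. det (moving_frame Q x)) -` {0<..})"
  have W': "open W'"
    unfolding W'_def by (intro open_Int continuous_open_preimage W cont continuous_on_det G open_greaterThan)
  define U where "U = sphere 0 1 \<inter> W'"
  have in_T: "moving_frame Q x \<in> T" if "x \<in> U" for x
  proof -
    have x: "norm x = 1" "x \<in> W" "moving_frame Q x \<in> G" "det (moving_frame Q x) > 0"
      using that by (auto simp: U_def W'_def)
    have "orthogonal_matrix (moving_frame Q x)"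
      using x by (intro orthogonal_moving_frame orth) (auto simp: W_def x0_def)
    moreover from this have "det (moving_frame Q x) = 1" using det_orthogonal_matrix x(4) by fastforce
    ultimately show ?thesis using x G by (simp add: rotation_matrix_def)
  qed
  define s where "s = q \<circ> moving_frame Q"
  have Fs: "F (s x) = moving_frame Q x" if "x \<in> U" for x
    using homeomorphism_apply2[OF q in_T[OF that]] by (simp add: s_def)
  have sP: "s x \<in> P" if "x \<in> U" for x
    using in_T[OF that] homeomorphism_image2[OF q] u T(3) by (fastforce simp: s_def)
  have bp: "base_point (moving_frame Q x) = x" if "x \<in> U" for x
    using that by (intro base_point_moving_frame orth) (auto simp: U_def W'_def W_def x0_def)
  have x0U: "x0 \<in> U"
    using n0 T(1) G orth moving_frame_id[OF orth(1)] by (simp add: U_def W'_def W_def x0_def norm_eq_1)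
  have "continuous_on U s" unfolding s_def
  proof (rule continuous_on_compose)
    show "continuous_on U (moving_frame Q)"
      by (rule continuous_on_subset[OF cont]) (auto simp: U_def W'_def)
    show "continuous_on (moving_frame Q ` U) q"
      using homeomorphism_cont2[OF q] by (rule continuous_on_subset) (use in_T in blast)
  qed
  moreover have "smooth_on_subset U (F \<circ> s)"
    unfolding smooth_on_subset_def
    by (intro ballI exI[of _ W] exI[of _ "moving_frame Q"]) (use W Ck Fs in \<open>auto simp: U_def W'_def\<close>)
  moreover have "openin (top_of_set (sphere 0 1)) U"
    unfolding U_def using W' by (rule openin_open_Int)
  ultimately have "smooth_local_section P F U s"
    unfolding smooth_local_section_def using sP Fs bp by simp
  moreover have "s x0 = p"
    using moving_frame_id[OF orth(1)] homeomorphism_apply1[OF q u(2)] by (simp add: s_def x0_def Q_def)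
  ultimately show ?thesis using x0U Fs
    by (intro that[of U s]) (auto simp: x0_def Q_def U_def W'_def W_def)
qed

lemma smooth_local_section_restrict:
  assumes "smooth_local_section P F U s" "open N"
  shows "smooth_local_section P F (U \<inter> N) s"
  using assms unfolding smooth_local_section_def
  by (auto intro: openin_Int_open continuous_on_subset smooth_on_subset_mono)

lemma spin_structure_orthogonal:
  assumes "spin_structure cl P F act" "p \<in> P"
  shows "orthogonal_matrix (F p)"
  using assms by (auto simp: spin_structure_def covering_space_def rotation_matrix_def)

lemma spin_structure_over_point:
  fixes F :: "'p::topological_space \<Rightarrow> real ^ ('n::finite option) ^ ('n option)"
  assumes "spin_structure cl P F act" "norm x = 1"
  obtains p where "p \<in> P" "base_point (F p) = x"
proof -
  have "2 \<le> CARD('n option)" using zero_less_card_finite[where 'a='n] by (simp add: Suc_le_eq)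
  then obtain R where R: "rotation_matrix R" "R *v axis None 1 = x"
    using rotation_matrix_exists_basis[OF _ assms(2)] by metis
  then have "R \<in> F ` P" using assms(1) by (simp add: spin_structure_def covering_space_def)
  then show ?thesis using R(2) that by (auto simp: base_point_def matrix_vector_mult_basis)
qed

section \<open>The curvature identity\<close>

text \<open>
  A spinor field satisfying the generalized Killing equation, viewed in the section through
  \<open>p\<close> whose frame is carried along great circles from the base point of
  \<open>p\<close>.
\<close>

locale killing_gauge = skew_clifford_module cl
  for cl :: "real ^ 'n::finite \<Rightarrow> 's::euclidean_space \<Rightarrow> 's" +
  fixes P :: "'p::topological_space set"
    and F :: "'p \<Rightarrow> real ^ ('n option) ^ ('n option)"
    and act :: "'p \<Rightarrow> ('s \<Rightarrow> 's) \<Rightarrow> 'p"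
    and A :: "real ^ ('n option) \<Rightarrow> real ^ ('n option) \<Rightarrow> real ^ ('n option)"
    and \<Psi> :: "'p \<Rightarrow> 's" and p :: 'p
    and U :: "(real ^ ('n option)) set" and s :: "real ^ ('n option) \<Rightarrow> 'p"
  assumes killing: "generalized_killing_with cl P F act A \<Psi>"
    and orth: "orthogonal_matrix (F p)"
    and sec: "smooth_local_section P F U s"
    and base: "base_point (F p) \<in> U" "s (base_point (F p)) = p"
    and frame: "\<And>x. x \<in> U \<Longrightarrow> norm x = 1 \<and> 1 + base_point (F p) \<bullet> x > 0 \<and> F (s x) = moving_frame (F p) x"
begin

abbreviation "Q \<equiv> F p"
abbreviation "x0 \<equiv> base_point (F p)"

lemma openU: "openin (top_of_set (sphere 0 1)) U"
  using sec by (simp add: smooth_local_section_def)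

lemma norm_x0: "norm x0 = 1" by (rule frame_orthonormal(1)[OF orth])

lemma smooth_A: "smooth_on_subset (sphere 0 1) (\<lambda>x. A x (v - (v \<bullet> x) *\<^sub>R x))"
  using killing by (simp add: generalized_killing_with_def symmetric_endo_field_def)

lemma smooth_spinor: "smooth_on_subset U (\<Psi> \<circ> s)"
  using killing sec by (auto simp: generalized_killing_with_def spinor_field_def)

text \<open>
  The connection form, as a matrix in the frame indices, is a multiple of the antisymmetrised
  product of the coordinate vectors of \<open>X\<close> and \<open>x\<close>, so its Clifford
  action is the commutator of the two.
\<close>

lemma gauge_equation:
  assumes x: "x \<in> U" and X: "X \<bullet> x = 0"
  shows "sphere_deriv (\<Psi> \<circ> s) x X = cl (frame_coords (moving_frame Q x) (A x X)) (\<Psi> (s x)) -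
    (inverse (1 + x0 \<bullet> x) / 4) *\<^sub>R (cl (frame_coords Q X) (cl (frame_coords Q x) (\<Psi> (s x))) -
      cl (frame_coords Q x) (cl (frame_coords Q X) (\<Psi> (s x))))"
proof -
  define k where "k = inverse (1 + x0 \<bullet> x)"
  let ?X = "frame_coords Q X" and ?x = "frame_coords Q x" and ?\<phi> = "\<Psi> (s x)"
  have con: "sphere_deriv (\<lambda>y. frame_vec (F (s y)) i) x X \<bullet> frame_vec (F (s x)) j =
      k * (?X $ i * ?x $ j) - k * (?x $ i * ?X $ j)" for i j
  proof -
    have ne: "1 + x0 \<bullet> x \<noteq> 0" using frame[OF x] by simp
    obtain D where D: "((\<lambda>y. great_circle_rotation x0 y (frame_vec Q i)) has_derivative D) (at x)"
      using great_circle_rotation_has_derivative[OF ne frame_orthonormal(3)[OF orth]] by blast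
    have "sphere_deriv (\<lambda>y. frame_vec (F (s y)) i) x X = D X"
      by (rule sphere_deriv_transform[OF openU x _ D X]) (simp add: frame frame_vec_moving_frame)
    then have "sphere_deriv (\<lambda>y. frame_vec (F (s y)) i) x X \<bullet> frame_vec (F (s x)) j =
        inverse (1 + x0 \<bullet> x) * ((frame_vec Q i \<bullet> X) * (frame_vec Q j \<bullet> x) - (frame_vec Q i \<bullet> x) * (frame_vec Q j \<bullet> X))"
      using frame[OF x] ne X frame_orthonormal(3)[OF orth]
      by (simp add: frame_vec_moving_frame great_circle_connection[OF norm_x0 _ _ _ _ _ D])
    then show ?thesis by (simp add: k_def frame_coords_def right_diff_distrib)
  qed
  have "spin_nabla cl F s \<Psi> x X = cl_mult cl F (s x) (A x X) ?\<phi>"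
    using killing sec x X unfolding generalized_killing_with_def by blast
  moreover have "(\<Sum>i\<in>UNIV. \<Sum>j\<in>UNIV.
        (sphere_deriv (\<lambda>y. frame_vec (F (s y)) i) x X \<bullet> frame_vec (F (s x)) j) *\<^sub>R
          cl (axis i 1) (cl (axis j 1) ?\<phi>)) = k *\<^sub>R cl ?X (cl ?x ?\<phi>) - k *\<^sub>R cl ?x (cl ?X ?\<phi>)"
    unfolding con scaleR_diff_left sum_subtractf
    by (simp add: cl_cl_expand[of ?X ?x] cl_cl_expand[of ?x ?X] scaleR_sum_right)
  ultimately have "sphere_deriv (\<Psi> \<circ> s) x X + (1/4) *\<^sub>R (k *\<^sub>R cl ?X (cl ?x ?\<phi>) - k *\<^sub>R cl ?x (cl ?X ?\<phi>))
      = cl (frame_coords (moving_frame Q x) (A x X)) ?\<phi>"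
    using frame[OF x] by (simp add: spin_nabla_def cl_mult_def)
  then show ?thesis unfolding k_def[symmetric]
    by (simp add: scaleR_diff_right eq_diff_eq)
qed

text \<open>
  Extending functions on \<open>U\<close> to this open cone by homogeneity of degree
  \<open>0\<close> makes the calculus of the ambient vector space available.
\<close>

definition "domain_cone = {v. v \<noteq> 0 \<and> sgn v \<in> U}"

lemma open_domain_cone: "open domain_cone"
proof -
  obtain G where G: "open G" "U = sphere 0 1 \<inter> G" using openU by (auto simp: openin_open)
  have "domain_cone = (- {0}) \<inter> sgn -` G" unfolding domain_cone_def unfolding G(2) by (auto simp: norm_sgn)
  moreover have "continuous_on (- {0}) (sgn :: real ^ ('n option) \<Rightarrow> _)"
    by (intro continuous_on_sgn continuous_on_id) auto
  ultimately show ?thesis using G(1) by (auto intro!: continuous_open_preimage)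
qed

lemma U_sgn: "x \<in> U \<Longrightarrow> sgn x = x \<and> x \<noteq> 0" using frame[of x] by (auto simp: sgn_div_norm)

lemma x0_domain_cone: "x0 \<in> domain_cone" using base U_sgn by (simp add: domain_cone_def)

definition "ext v = \<Psi> (s (sgn v))"

text \<open>
  The derivative of \<open>ext\<close>: a displacement \<open>Y\<close> of \<open>v\<close> moves
  \<open>sgn v\<close> by the tangential part of \<open>Y\<close> divided by \<open>|v|\<close>.
\<close>

definition "ext_deriv v Y = inverse (norm v) *\<^sub>R sphere_deriv (\<Psi> \<circ> s) (sgn v) (Y - (Y \<bullet> sgn v) *\<^sub>R sgn v)"

lemma ext_has_derivative:
  assumes "v \<in> domain_cone"
  shows "(ext has_derivative ext_deriv v) (at v)"
proof -
  define x where "x = sgn v"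
  have v: "v \<noteq> 0" "x \<in> U" "sgn x = x" "norm x = 1" using assms U_sgn frame by (auto simp: domain_cone_def x_def)
  obtain W g where W: "open W" "x \<in> W" "\<And>y. y \<in> W \<Longrightarrow> g differentiable (at y)"
    "\<And>y. y \<in> W \<Longrightarrow> y \<in> U \<Longrightarrow> g y = (\<Psi> \<circ> s) y"
    using smooth_on_subset_differentiable[OF smooth_spinor v(2)] by blast
  obtain D where D: "(g has_derivative D) (at x)" using W(2,3) by (auto simp: differentiable_def)
  have D_eq: "sphere_deriv (\<Psi> \<circ> s) x X = D X" if "X \<bullet> x = 0" for X
  proof (rule sphere_deriv_transform[OF _ _ _ D that])
    show "openin (top_of_set (sphere 0 1)) (U \<inter> W)" using openU W(1) by (rule openin_Int_open)
  qed (use v W in auto)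
  have "((\<lambda>y. g (sgn y)) has_derivative
      (\<lambda>h. D (inverse (norm v) *\<^sub>R (h - (h \<bullet> sgn v) *\<^sub>R sgn v)))) (at v)"
    by (rule has_derivative_compose[OF has_derivative_sgn[OF v(1)] D[unfolded x_def]])
  moreover have "D (inverse (norm v) *\<^sub>R (h - (h \<bullet> sgn v) *\<^sub>R sgn v)) = ext_deriv v h" for h
  proof -
    have "(h - (h \<bullet> x) *\<^sub>R x) \<bullet> x = 0" using v(4) by (simp add: inner_diff_left norm_eq_1)
    then show ?thesis
      using linear_scale[OF has_derivative_linear[OF D]] D_eq by (simp add: ext_deriv_def x_def)
  qed
  ultimately have "((\<lambda>y. g (sgn y)) has_derivative ext_deriv v) (at v)" by simp
  moreover have "\<forall>\<^sub>F y in at v. g (sgn y) = ext y"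
  proof -
    have "(sgn \<longlongrightarrow> x) (at v)"
      using has_derivative_continuous[OF has_derivative_sgn[OF v(1)]] by (simp add: continuous_at x_def)
    then have "\<forall>\<^sub>F y in at v. sgn y \<in> W" using topological_tendstoD W(1,2) by blast
    moreover have "\<forall>\<^sub>F y in at v. y \<in> domain_cone" using open_domain_cone assms eventually_at_topological by blast
    ultimately show ?thesis by eventually_elim (use W(4) in \<open>auto simp: ext_def domain_cone_def\<close>)
  qed
  moreover have "g (sgn v) = ext v" using W(2,4) v(2) by (simp add: ext_def x_def)
  ultimately show ?thesis by (rule has_derivative_transform_eventually) simp
qed

text \<open>
  The endomorphism \<open>A\<close> in coordinates of the moving frame, applied to the tangential
  part of a constant vector \<open>Y\<close> and scaled like \<open>ext_deriv\<close>.
\<close>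

definition "endo v Y = inverse (norm v) *\<^sub>R
  frame_coords (moving_frame Q (sgn v)) (A (sgn v) (Y - (Y \<bullet> sgn v) *\<^sub>R sgn v))"

text \<open>
  With \<open>weight\<close>, the Clifford action of the connection form.  Unlike
  \<open>sphere_deriv\<close>, the resulting formula for \<open>ext_deriv\<close> can be
  differentiated once more.
\<close>

definition "potential v Y = cl (frame_coords Q Y) (cl (frame_coords Q (sgn v)) (ext v)) -
  cl (frame_coords Q (sgn v)) (cl (frame_coords Q Y) (ext v))"

definition "weight v = inverse (4 * norm v * (1 + x0 \<bullet> sgn v))"

text \<open>
  Replacing \<open>Y\<close> by its tangential part does not change the commutator with \<open>sgn
  v\<close>, so \<open>potential\<close> can be defined with \<open>Y\<close> itself.
\<close>

lemma ext_deriv_eq: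
  assumes "v \<in> domain_cone"
  shows "ext_deriv v Y = cl (endo v Y) (ext v) - weight v *\<^sub>R potential v Y"
proof -
  define x where "x = sgn v"
  define X where "X = Y - (Y \<bullet> x) *\<^sub>R x"
  have x: "x \<in> U" "norm x = 1" using assms frame by (auto simp: domain_cone_def x_def)
  have "X \<bullet> x = 0" using x(2) by (simp add: X_def inner_diff_left norm_eq_1)
  note eq = gauge_equation[OF x(1) this]
  have X': "frame_coords Q X = frame_coords Q Y - (Y \<bullet> x) *\<^sub>R frame_coords Q x"
    by (simp add: X_def linear_diff[OF linear_frame_coords] linear_scale[OF linear_frame_coords])
  have "cl (frame_coords Q X) (cl (frame_coords Q x) (ext v)) - cl (frame_coords Q x) (cl (frame_coords Q X) (ext v))
      = potential v Y"
    unfolding X' by (simp add: cl_simps potential_def x_def)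
  then show ?thesis
    using eq unfolding ext_deriv_def x_def[symmetric] X_def[symmetric] endo_def weight_def
    by (simp add: cl_simps scaleR_diff_right ext_def x_def mult.commute)
qed

lemma endo_differentiable:
  shows "(\<lambda>v. endo v Y) differentiable (at x0)"
proof -
  have x0: "x0 \<in> sphere 0 1" "x0 \<noteq> 0" "sgn x0 = x0" using norm_x0 U_sgn[OF base(1)] by auto
  obtain W g where W: "open W" "x0 \<in> W" "\<And>y. y \<in> W \<Longrightarrow> g differentiable (at y)"
    "\<And>y. y \<in> W \<Longrightarrow> y \<in> sphere 0 1 \<Longrightarrow> g y = A y (Y - (Y \<bullet> y) *\<^sub>R y)"
    using smooth_on_subset_differentiable[OF smooth_A x0(1)] by blast
  have sgn_diff: "sgn differentiable (at x0)"
    using has_derivative_sgn[OF x0(2)] by (rule differentiableI)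
  have gs: "(\<lambda>v. g (sgn v)) differentiable (at x0)"
    using differentiable_chain_at[OF sgn_diff, of g] W(2,3) x0(3) by (simp add: o_def)
  have ne: "1 + x0 \<bullet> x0 \<noteq> 0" using norm_x0 by (simp add: norm_eq_1)
  have e: "(\<lambda>v. great_circle_rotation x0 (sgn v) (frame_vec Q i)) differentiable (at x0)" for i
    using differentiable_chain_at[OF sgn_diff, of "\<lambda>x. great_circle_rotation x0 x (frame_vec Q i)"]
      differentiableI[OF great_circle_rotation_has_derivative[OF ne frame_orthonormal(3)[OF orth]]] x0(3)
    by (simp add: o_def)
  have nrm: "(\<lambda>v. inverse (norm v)) differentiable (at x0)"
    using x0(2) by (intro differentiable_inverse differentiable_norm_at) auto
  let ?h = "\<lambda>v. \<Sum>i\<in>UNIV. (inverse (norm v) * (great_circle_rotation x0 (sgn v) (frame_vec Q i) \<bullet> g (sgn v)))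
      *\<^sub>R axis i (1::real)"
  have "?h differentiable (at x0)"
    by (intro differentiable_sum ballI differentiable_scaleR differentiable_mult differentiable_inner
        nrm e gs differentiable_const) simp
  then obtain D where D: "(?h has_derivative D) (at x0)" by (auto simp: differentiable_def)
  moreover have "\<forall>\<^sub>F v in at x0. ?h v = endo v Y"
  proof -
    have "(sgn \<longlongrightarrow> x0) (at x0)"
      using has_derivative_continuous[OF has_derivative_sgn[OF x0(2)]] x0(3) by (simp add: continuous_at)
    then have "\<forall>\<^sub>F y in at x0. sgn y \<in> W" using topological_tendstoD W(1,2) by blast
    moreover have "\<forall>\<^sub>F y in at x0. y \<in> domain_cone" using open_domain_cone x0_domain_cone eventually_at_topological by blast
    ultimately show ?thesis
    proof eventually_elim
      case (elim v)
      then have g: "g (sgn v) = A (sgn v) (Y - (Y \<bullet> sgn v) *\<^sub>R sgn v)"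
        using W(4) frame by (auto simp: domain_cone_def)
      have "endo v Y = (\<Sum>i\<in>UNIV. (endo v Y $ i) *\<^sub>R axis i 1)"
        using basis_expansion[of "endo v Y"] by (simp add: scalar_mult_eq_scaleR)
      then show ?case
        by (simp add: endo_def frame_coords_def g frame_vec_moving_frame)
    qed
  qed
  moreover have "?h x0 = endo x0 Y"
  proof -
    have g: "g (sgn x0) = A (sgn x0) (Y - (Y \<bullet> sgn x0) *\<^sub>R sgn x0)"
      using W(2,4) x0 by auto
    have "endo x0 Y = (\<Sum>i\<in>UNIV. (endo x0 Y $ i) *\<^sub>R axis i 1)"
      using basis_expansion[of "endo x0 Y"] by (simp add: scalar_mult_eq_scaleR)
    then show ?thesis
      by (simp add: endo_def frame_coords_def g frame_vec_moving_frame)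
  qed
  ultimately have "((\<lambda>v. endo v Y) has_derivative D) (at x0)"
    by (rule has_derivative_transform_eventually) simp
  then show ?thesis by (rule differentiableI)
qed

text \<open>
  The connection term \<open>potential\<close> vanishes at \<open>x0\<close>; hence neither the
  derivative of \<open>weight\<close> nor that of \<open>ext\<close> contributes to its derivative
  there.  The linear map \<open>B\<close> is the derivative of the vector-valued function
  \<open>endo\<close> and remains unspecified.
\<close>

lemma ext_deriv_has_derivative:
  obtains B where
    "((\<lambda>v. ext_deriv v Y) has_derivative
      (\<lambda>h. cl (endo x0 Y) (ext_deriv x0 h) + cl (B h) (ext x0) -
        (1/8) *\<^sub>R (cl (frame_coords Q Y) (cl (frame_coords Q h) (ext x0)) -
          cl (frame_coords Q h) (cl (frame_coords Q Y) (ext x0))))) (at x0)"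
proof -
  have x0: "x0 \<noteq> 0" "sgn x0 = x0" using U_sgn[OF base(1)] by auto
  note dext = ext_has_derivative[OF x0_domain_cone]
  note dcl = bounded_bilinear.FDERIV[OF bounded_bilinear_cl]
  obtain B where B: "((\<lambda>v. endo v Y) has_derivative B) (at x0)"
    using endo_differentiable by (auto simp: differentiable_def)
  have fc0: "frame_coords Q (sgn x0) = 0" using frame_coords_base_point[OF orth] x0 by simp
  have dfc: "((\<lambda>v. frame_coords Q (sgn v)) has_derivative (\<lambda>h. frame_coords Q h)) (at x0)"
  proof -
    have "bounded_linear (frame_coords Q)"
      using linear_frame_coords by (simp add: linear_conv_bounded_linear)
    from bounded_linear.has_derivative[OF this has_derivative_sgn[OF x0(1)]]
    show ?thesis using fc0 x0(2) norm_x0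
      by (simp add: linear_diff[OF linear_frame_coords] linear_scale[OF linear_frame_coords])
  qed
  have dpot: "((\<lambda>v. potential v Y) has_derivative
     (\<lambda>h. cl (frame_coords Q Y) (cl (frame_coords Q h) (ext x0)) -
          cl (frame_coords Q h) (cl (frame_coords Q Y) (ext x0)))) (at x0)"
    using has_derivative_diff[OF dcl[OF has_derivative_const dcl[OF dfc dext]]
        dcl[OF dfc dcl[OF has_derivative_const dext]], of "frame_coords Q Y" "frame_coords Q Y"]
    by (simp add: potential_def fc0 cl_simps)
  have pot0: "potential x0 Y = 0" by (simp add: potential_def fc0 cl_simps)
  have w0: "weight x0 = 1/8" using norm_x0 x0(2) by (simp add: weight_def norm_eq_1)
  have "weight differentiable (at x0)"
  proof -
    have "(\<lambda>v. 4 * norm v * (1 + x0 \<bullet> sgn v)) differentiable (at x0)"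
      using x0(1) differentiableI[OF has_derivative_sgn[OF x0(1)]]
      by (intro differentiable_mult differentiable_add differentiable_inner differentiable_const
          differentiable_norm_at)
    then show ?thesis unfolding weight_def using w0 x0 norm_x0
      by (intro differentiable_inverse) (auto simp: norm_eq_1)
  qed
  then obtain w' where "(weight has_derivative w') (at x0)" by (auto simp: differentiable_def)
  from has_derivative_scaleR[OF this dpot]
  have dwp: "((\<lambda>v. weight v *\<^sub>R potential v Y) has_derivative
     (\<lambda>h. (1/8) *\<^sub>R (cl (frame_coords Q Y) (cl (frame_coords Q h) (ext x0)) -
          cl (frame_coords Q h) (cl (frame_coords Q Y) (ext x0))))) (at x0)"
    by (simp add: pot0 w0)
  have "((\<lambda>v. cl (endo v Y) (ext v) - weight v *\<^sub>R potential v Y) has_derivative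
      (\<lambda>h. cl (endo x0 Y) (ext_deriv x0 h) + cl (B h) (ext x0) -
        (1/8) *\<^sub>R (cl (frame_coords Q Y) (cl (frame_coords Q h) (ext x0)) -
          cl (frame_coords Q h) (cl (frame_coords Q Y) (ext x0))))) (at x0)"
    by (intro has_derivative_diff dcl[OF B dext] dwp)
  from has_derivative_transform_within_open[OF this open_domain_cone x0_domain_cone, of "\<lambda>v. ext_deriv v Y"]
  show ?thesis using that ext_deriv_eq by simp
qed

lemma ext_deriv_base:
  assumes "X \<bullet> x0 = 0"
  shows "ext_deriv x0 X = cl (frame_coords Q (A x0 X)) (\<Psi> p)" "endo x0 X = frame_coords Q (A x0 X)"
    "ext x0 = \<Psi> p"
proof -
  have x0: "x0 \<noteq> 0" "sgn x0 = x0" using U_sgn[OF base(1)] by auto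
  show e: "endo x0 X = frame_coords Q (A x0 X)" "ext x0 = \<Psi> p"
    using assms x0 norm_x0 base(2) moving_frame_id[OF orth] by (auto simp: endo_def ext_def)
  show "ext_deriv x0 X = cl (frame_coords Q (A x0 X)) (\<Psi> p)"
    using ext_deriv_eq[OF x0_domain_cone, of X] e x0(2) frame_coords_base_point[OF orth]
    by (simp add: potential_def cl_simps)
qed

text \<open>
  Symmetry of the second derivative of \<open>ext\<close> at \<open>x0\<close>.  The two
  derivatives of \<open>A\<close> combine into the vector \<open>T\<close>, the first-order terms
  give the commutator of \<open>A X\<close> and \<open>A Y\<close>, and the two connection terms,
  each with factor \<open>1/8\<close>, add up to the curvature term of the round sphere.
\<close>

lemma curvature_identity:
  assumes X: "X \<bullet> x0 = 0" and Y: "Y \<bullet> x0 = 0"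
  defines "a \<equiv> frame_coords Q (A x0 X)" and "b \<equiv> frame_coords Q (A x0 Y)"
  shows "\<exists>T. cl T (\<Psi> p) = cl a (cl b (\<Psi> p)) - cl b (cl a (\<Psi> p)) -
    (1/4) *\<^sub>R (cl (frame_coords Q X) (cl (frame_coords Q Y) (\<Psi> p)) -
      cl (frame_coords Q Y) (cl (frame_coords Q X) (\<Psi> p)))"
proof -
  let ?\<phi> = "\<Psi> p" and ?X = "frame_coords Q X" and ?Y = "frame_coords Q Y"
  obtain B1 where B1: "((\<lambda>v. ext_deriv v X) has_derivative
      (\<lambda>h. cl (endo x0 X) (ext_deriv x0 h) + cl (B1 h) (ext x0) -
        (1/8) *\<^sub>R (cl (frame_coords Q X) (cl (frame_coords Q h) (ext x0)) -
          cl (frame_coords Q h) (cl (frame_coords Q X) (ext x0))))) (at x0)"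
    by (rule ext_deriv_has_derivative)
  obtain B2 where B2: "((\<lambda>v. ext_deriv v Y) has_derivative
      (\<lambda>h. cl (endo x0 Y) (ext_deriv x0 h) + cl (B2 h) (ext x0) -
        (1/8) *\<^sub>R (cl (frame_coords Q Y) (cl (frame_coords Q h) (ext x0)) -
          cl (frame_coords Q h) (cl (frame_coords Q Y) (ext x0))))) (at x0)"
    by (rule ext_deriv_has_derivative)
  have "cl a (cl b ?\<phi>) + cl (B1 Y) ?\<phi> - (1/8) *\<^sub>R (cl ?X (cl ?Y ?\<phi>) - cl ?Y (cl ?X ?\<phi>))
     = cl b (cl a ?\<phi>) + cl (B2 X) ?\<phi> - (1/8) *\<^sub>R (cl ?Y (cl ?X ?\<phi>) - cl ?X (cl ?Y ?\<phi>))"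
    using symmetric_second_derivative[OF open_domain_cone x0_domain_cone ext_has_derivative B1 B2]
    by (simp add: ext_deriv_base[OF X] ext_deriv_base[OF Y] a_def b_def)
  moreover have "(1/8) *\<^sub>R u + (1/8) *\<^sub>R u = (1/4) *\<^sub>R u" for u :: 's
    by (simp flip: scaleR_add_left)
  ultimately have "cl (B2 X - B1 Y) ?\<phi> = cl a (cl b ?\<phi>) - cl b (cl a ?\<phi>) -
     (1/4) *\<^sub>R (cl ?X (cl ?Y ?\<phi>) - cl ?Y (cl ?X ?\<phi>))"
    by (simp add: cl_simps algebra_simps)
  then show ?thesis by blast
qed

text \<open>
  Since the connection form vanishes at \<open>x0\<close>, the left-hand side of the conclusion is
  the derivative at \<open>x0\<close> of the function assumed to vanish near \<open>x0\<close>.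
\<close>

lemma chirality_derivative:
  assumes "linear vol" and zero: "\<And>x. x \<in> U \<Longrightarrow> \<Psi> (s x) \<bullet> vol (\<Psi> (s x)) = 0"
    and X: "X \<bullet> x0 = 0"
  defines "a \<equiv> frame_coords Q (A x0 X)"
  shows "cl a (\<Psi> p) \<bullet> vol (\<Psi> p) + \<Psi> p \<bullet> vol (cl a (\<Psi> p)) = 0"
proof -
  note dext = ext_has_derivative[OF x0_domain_cone]
  have "bounded_linear vol" using assms(1) by (simp add: linear_conv_bounded_linear)
  note dvol = bounded_linear.has_derivative[OF this dext]
  have "((\<lambda>v. ext v \<bullet> vol (ext v)) has_derivative
      (\<lambda>h. ext x0 \<bullet> vol (ext_deriv x0 h) + ext_deriv x0 h \<bullet> vol (ext x0))) (at x0)"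
    by (rule has_derivative_inner[OF dext dvol])
  moreover have "((\<lambda>v. ext v \<bullet> vol (ext v)) has_derivative (\<lambda>h. 0)) (at x0)"
    by (rule has_derivative_transform_within_open[OF has_derivative_const[of 0] open_domain_cone x0_domain_cone])
      (use zero in \<open>auto simp: ext_def domain_cone_def\<close>)
  ultimately have "(\<lambda>h. ext x0 \<bullet> vol (ext_deriv x0 h) + ext_deriv x0 h \<bullet> vol (ext x0)) = (\<lambda>h. 0)"
    by (rule has_derivative_unique)
  then have "ext x0 \<bullet> vol (ext_deriv x0 X) + ext_deriv x0 X \<bullet> vol (ext x0) = 0" by meson
  then show ?thesis using ext_deriv_base[OF X] by (simp add: a_def)
qed

end

section \<open>Rigidity of generalized Killing spinors\<close>

text \<open>
  Translates \<open>curvature_rigidity\<close> from frame coordinates at \<open>p\<close> to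
  tangent vectors.  The first conclusion is the non-vanishing of \<open>A \<eta>\<close> in the
  form in which it contradicts \<open>chirality_derivative\<close>; the hypothesis of the second
  one says that the two half-spinors have different norms.
\<close>

lemma pointwise_rigidity:
  fixes cl :: "real ^ 'n::finite \<Rightarrow> 's::euclidean_space \<Rightarrow> 's"
    and F :: "'p::topological_space \<Rightarrow> real ^ ('n option) ^ ('n option)"
  assumes "skew_clifford_module cl" "CARD('n) \<ge> 3"
    and ss: "spin_structure cl P F act" and gk: "generalized_killing_with cl P F act A \<Psi>" and "p \<in> P"
    and vol: "linear vol" "\<And>v \<phi>. vol (cl v \<phi>) = - cl v (vol \<phi>)" "vol \<phi>p = \<phi>p" "vol \<phi>m = - \<phi>m"
    and \<Psi>: "\<Psi> p = \<phi>p + \<phi>m"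
    and \<eta>: "\<And>X. X \<bullet> base_point (F p) = 0 \<Longrightarrow> \<eta> \<bullet> X = cl_mult cl F p X \<phi>p \<bullet> \<phi>m"
      "\<eta> \<bullet> base_point (F p) = 0" "\<eta> \<noteq> 0"
  shows "\<exists>X. X \<bullet> base_point (F p) = 0 \<and> cl_mult cl F p (A (base_point (F p)) X) \<phi>p \<bullet> \<phi>m \<noteq> 0"
    and "\<Psi> p \<bullet> vol (\<Psi> p) \<noteq> 0 \<Longrightarrow>
      \<exists>c. c\<^sup>2 = 1/4 \<and> (\<forall>X. X \<bullet> base_point (F p) = 0 \<longrightarrow> A (base_point (F p)) X = c *\<^sub>R X)"
proof -
  define Q where "Q = F p"
  define x0 where "x0 = base_point Q"
  have orth: "orthogonal_matrix Q" using spin_structure_orthogonal[OF ss \<open>p \<in> P\<close>] by (simp add: Q_def)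
  have x0: "x0 \<in> sphere 0 1" using frame_orthonormal(1)[OF orth] by (simp add: x0_def)
  have A: "A x0 X \<bullet> x0 = 0" "A x0 (c *\<^sub>R X) = c *\<^sub>R A x0 X" if "X \<bullet> x0 = 0" for X c
    using gk x0 that unfolding generalized_killing_with_def symmetric_endo_field_def by blast+
  have A2: "A x0 (X + Y) = A x0 X + A x0 Y" "A x0 X \<bullet> Y = X \<bullet> A x0 Y"
    if "X \<bullet> x0 = 0" "Y \<bullet> x0 = 0" for X Y
    using gk x0 that unfolding generalized_killing_with_def symmetric_endo_field_def by blast+
  define B where "B V = frame_coords Q (A x0 (frame_map Q V))" for V
  have tan: "frame_map Q V \<bullet> x0 = 0" for V using frame_map_tangent[OF orth] by (simp add: x0_def)
  have linB: "linear B"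
    by (rule linearI)
      (simp_all add: B_def linear_add[OF linear_frame_map] linear_scale[OF linear_frame_map] A A2 tan
        linear_add[OF linear_frame_coords] linear_scale[OF linear_frame_coords])
  have symB: "B V \<bullet> W = V \<bullet> B W" for V W
  proof -
    have "B V \<bullet> W = frame_map Q V \<bullet> A x0 (frame_map Q W)"
      by (simp add: B_def frame_coords_inner A2(2)[OF tan tan])
    also have "\<dots> = V \<bullet> B W" unfolding B_def using frame_coords_inner by (metis inner_commute)
    finally show ?thesis .
  qed
  define h where "h = frame_coords Q \<eta>"
  have h: "h \<bullet> V = cl V \<phi>p \<bullet> \<phi>m" for V
    using \<eta>(1)[of "frame_map Q V"] tan[of V]
    by (simp add: h_def frame_coords_inner cl_mult_def Q_def x0_def frame_coords_frame_map[OF orth[unfolded Q_def]])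
  have "h \<noteq> 0"
  proof
    assume "h = 0"
    have "\<eta> = frame_map Q h"
      using frame_map_frame_coords[OF orth, of \<eta>] \<eta>(2) by (simp add: h_def Q_def)
    then show False using \<eta>(3) \<open>h = 0\<close> linear_0[OF linear_frame_map[of Q]] by simp
  qed
  obtain U s where gauge: "smooth_local_section P F U s" "base_point (F p) \<in> U" "s (base_point (F p)) = p"
    "\<And>x. x \<in> U \<Longrightarrow> norm x = 1 \<and> 1 + base_point (F p) \<bullet> x > 0 \<and> F (s x) = moving_frame (F p) x"
    using moving_local_section[OF ss \<open>p \<in> P\<close>] by metis
  interpret skew_clifford_module cl by fact
  interpret G: killing_gauge cl P F act A \<Psi> p U s
    by unfold_locales (use gk orth gauge in \<open>simp_all add: Q_def\<close>)
  have curv: "\<exists>T. cl T (\<phi>p + \<phi>m) = cl (B V) (cl (B W) (\<phi>p + \<phi>m)) - cl (B W) (cl (B V) (\<phi>p + \<phi>m))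
        - (1/4) *\<^sub>R (cl V (cl W (\<phi>p + \<phi>m)) - cl W (cl V (\<phi>p + \<phi>m)))" for V W
    using G.curvature_identity[of "frame_map Q V" "frame_map Q W"] tan
    unfolding \<Psi> B_def x0_def Q_def frame_coords_frame_map[OF orth[unfolded Q_def]] by blast
  note rigid = curvature_rigidity[OF assms(1,2) linB symB curv vol h \<open>h \<noteq> 0\<close>]
  have "h \<bullet> B (B h) \<noteq> 0" using rigid(1) symB[of h "B h"] by (metis inner_eq_zero_iff)
  then show "\<exists>X. X \<bullet> base_point (F p) = 0 \<and> cl_mult cl F p (A (base_point (F p)) X) \<phi>p \<bullet> \<phi>m \<noteq> 0"
    using tan[of "B h"] unfolding h by (auto simp: B_def cl_mult_def Q_def x0_def)
  assume "\<Psi> p \<bullet> vol (\<Psi> p) \<noteq> 0"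
  moreover have "\<Psi> p \<bullet> vol (\<Psi> p) = \<phi>p \<bullet> \<phi>p - \<phi>m \<bullet> \<phi>m"
    unfolding \<Psi> linear_add[OF vol(1)] vol(3,4)
    by (simp add: inner_add_left inner_diff_right inner_commute[of \<phi>m \<phi>p])
  ultimately obtain c where c: "c\<^sup>2 = 1/4" "\<And>V. B V = c *\<^sub>R V" using rigid(2) by auto
  have "A x0 X = c *\<^sub>R X" if "X \<bullet> x0 = 0" for X
  proof -
    have "frame_map Q (B (frame_coords Q X)) = A x0 X"
      unfolding B_def using that A(1)[OF that] x0_def frame_map_frame_coords[OF orth] by simp
    then show ?thesis
      using that frame_map_frame_coords[OF orth, of X]
      by (simp add: c linear_scale[OF linear_frame_map] x0_def)
  qed
  with c(1) show "\<exists>c. c\<^sup>2 = 1/4 \<and> (\<forall>X. X \<bullet> base_point (F p) = 0 \<longrightarrow> A (base_point (F p)) X = c *\<^sub>R X)"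
    unfolding x0_def Q_def by blast
qed

definition scalar_points ::
    "(real ^ 'm::finite \<Rightarrow> real ^ 'm \<Rightarrow> real ^ 'm) \<Rightarrow> real \<Rightarrow> (real ^ 'm) set" where
  "scalar_points A c = {x \<in> sphere 0 1. \<forall>X. X \<bullet> x = 0 \<longrightarrow> A x X = c *\<^sub>R X}"

text \<open>
  Every tangent vector is the tangential part of a constant vector, so the condition is a family
  of equations between continuous functions on the sphere.
\<close>

lemma closed_scalar_points:
  assumes "symmetric_endo_field A"
  shows "closed (scalar_points A c)"
proof -
  have tan: "(v - (v \<bullet> x) *\<^sub>R x) \<bullet> x = 0" if "x \<in> sphere 0 1" for v x :: "real ^ 'a"
    using that by (simp add: inner_diff_left norm_eq_1)
  have "scalar_points A c =
     (\<Inter>v. {x \<in> sphere 0 1. A x (v - (v \<bullet> x) *\<^sub>R x) - c *\<^sub>R (v - (v \<bullet> x) *\<^sub>R x) = 0})" (is "_ = ?R")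
  proof
    show "scalar_points A c \<subseteq> ?R" using tan by (auto simp: scalar_points_def)
    show "?R \<subseteq> scalar_points A c"
    proof
      fix x assume x: "x \<in> ?R"
      have "A x X = c *\<^sub>R X" if "X \<bullet> x = 0" for X
      proof -
        have "A x (X - (X \<bullet> x) *\<^sub>R x) - c *\<^sub>R (X - (X \<bullet> x) *\<^sub>R x) = 0" using x by blast
        then show ?thesis using that by simp
      qed
      then show "x \<in> scalar_points A c" using x by (auto simp: scalar_points_def)
    qed
  qed
  moreover have "continuous_on (sphere 0 1) (\<lambda>x. A x (v - (v \<bullet> x) *\<^sub>R x))" for v
    using assms by (intro smooth_on_subset_continuous) (simp add: symmetric_endo_field_def)
  then have "closed ?R"
    by (intro closed_INT ballI continuous_closed_preimage_constant continuous_intros closed_sphere)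
  ultimately show ?thesis by (simp only:)
qed

lemma symmetric_endo_field_scalar: "symmetric_endo_field (\<lambda>x X :: real ^ 'm::finite. c *\<^sub>R X)"
proof -
  have "Ck_on k UNIV (\<lambda>x. c *\<^sub>R (v + (- 1) *\<^sub>R ((v \<bullet> x) *\<^sub>R x)))" for k and v :: "real ^ 'm"
    by (intro Ck_on_add Ck_on_bilinear[OF bounded_bilinear_scaleR] Ck_on_bilinear[OF bounded_bilinear_inner]
        Ck_on_const open_UNIV Ck_on_linear bounded_linear_ident)
  then have "smooth_on_subset (sphere 0 1) (\<lambda>x. c *\<^sub>R (v - (v \<bullet> x) *\<^sub>R x))" for v :: "real ^ 'm"
    unfolding smooth_on_subset_def
    by (intro ballI exI[of _ UNIV] exI[of _ "\<lambda>x. c *\<^sub>R (v - (v \<bullet> x) *\<^sub>R x)"]) simp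
  then show ?thesis by (simp add: symmetric_endo_field_def scaleR_add_right mult.commute)
qed

theorem theorem3p1:
  fixes k :: nat
    and cl :: "real ^ 'n::finite \<Rightarrow> 's::euclidean_space \<Rightarrow> 's"
    and es :: "'n list"
    and P :: "'p::topological_space set"
    and F :: "'p \<Rightarrow> real ^ ('n option) ^ ('n option)"
    and act :: "'p \<Rightarrow> ('s \<Rightarrow> 's) \<Rightarrow> 'p"
    and \<Psi> \<Psi>p \<Psi>m :: "'p \<Rightarrow> 's"
    and \<eta> :: "real ^ ('n option) \<Rightarrow> real ^ ('n option)"
  assumes "k \<ge> 1" and "CARD('n) = 8 * k"
    and "real_spin_module cl"
    and "distinct es" and "set es = UNIV"
    and "spin_structure cl P F act"
    and "generalized_killing_spinor cl P F act \<Psi>"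
    and "\<forall>p\<in>P. \<Psi> p = \<Psi>p p + \<Psi>m p \<and>
           \<Psi>p p \<in> half_spinors cl es 1 \<and> \<Psi>m p \<in> half_spinors cl es (- 1)"
    and "\<forall>x\<in>sphere 0 1. \<eta> x \<bullet> x = 0"
    and "\<forall>p\<in>P. \<forall>X. X \<bullet> base_point (F p) = 0 \<longrightarrow>
           \<eta> (base_point (F p)) \<bullet> X = cl_mult cl F p X (\<Psi>p p) \<bullet> \<Psi>m p"
    and "sphere 0 1 \<subseteq> closure {x \<in> sphere 0 1. \<eta> x \<noteq> 0}"
  shows "killing_spinor cl P F act \<Psi>"
proof -
  note ss = assms(6)
  obtain A where gk: "generalized_killing_with cl P F act A \<Psi>"
    using assms(7) by (auto simp: generalized_killing_spinor_def)
  have cm: "skew_clifford_module cl" by (rule real_spin_module_skew_clifford[OF assms(3)])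
  interpret skew_clifford_module cl by (rule cm)
  have n3: "CARD('n) \<ge> 3" using assms(1,2) by simp
  define vol where "vol = volume_element cl es"
  have vol: "linear vol" "\<And>v \<phi>. vol (cl v \<phi>) = - cl v (vol \<phi>)"
    using assms(2) volume_element_anticommute[OF assms(4,5)] linear_volume_element by (auto simp: vol_def)
  have dec: "\<Psi> p = \<Psi>p p + \<Psi>m p" "vol (\<Psi>p p) = \<Psi>p p" "vol (\<Psi>m p) = - \<Psi>m p" if "p \<in> P" for p
    using assms(8) that by (auto simp: half_spinors_def vol_def)
  have \<eta>: "\<eta> (base_point (F p)) \<bullet> X = cl_mult cl F p X (\<Psi>p p) \<bullet> \<Psi>m p"
    if "p \<in> P" "X \<bullet> base_point (F p) = 0" for p X using assms(10) that by blast
  have on_sphere: "base_point (F p) \<in> sphere 0 1" if "p \<in> P" for p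
    using frame_orthonormal(1)[OF spin_structure_orthogonal[OF ss that]] by simp
  note rigid = pointwise_rigidity[OF cm n3 ss gk _ vol(1) vol(2) dec(2,3) dec(1) \<eta>]
  define K where "K = scalar_points A (1/2) \<union> scalar_points A (- 1/2)"
  have sA: "symmetric_endo_field A" using gk by (simp add: generalized_killing_with_def)
  have closedK: "closed K" unfolding K_def by (intro closed_Un closed_scalar_points sA)
  \<comment> \<open>the points where neither \<open>\<eta>\<close> nor the difference \<open>f\<close> of the squared norms of the half-spinors vanishes\<close>
  have inK: "base_point (F p) \<in> K"
    if p: "p \<in> P" and "\<eta> (base_point (F p)) \<noteq> 0" "\<Psi> p \<bullet> vol (\<Psi> p) \<noteq> 0" for p
  proof -
    have "\<exists>c. c\<^sup>2 = 1/4 \<and> (\<forall>X. X \<bullet> base_point (F p) = 0 \<longrightarrow> A (base_point (F p)) X = c *\<^sub>R X)"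
      by (rule rigid(2)[OF p p p p p]) (use that on_sphere[OF p] assms(9) in auto)
    then obtain c where c: "c\<^sup>2 = 1/4"
        "\<And>X. X \<bullet> base_point (F p) = 0 \<Longrightarrow> A (base_point (F p)) X = c *\<^sub>R X" by blast
    have "c\<^sup>2 = (1/2)\<^sup>2" using c(1) by (simp add: power2_eq_square)
    then have "c = 1/2 \<or> c = - 1/2" by (simp add: power2_eq_iff)
    then show ?thesis using c(2) on_sphere[OF p] by (auto simp: K_def scalar_points_def)
  qed
  \<comment> \<open>points with \<open>\<eta> \<noteq> 0\<close> at which \<open>f\<close> may vanish are limits of the former\<close>
  have "x \<in> closure K" if x: "x \<in> sphere 0 1" "\<eta> x \<noteq> 0" for x
    unfolding closure_iff_nhds_not_empty
  proof (intro allI impI)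
    fix M N assume N: "N \<subseteq> M" "open N" "x \<in> N"
    obtain p where p: "p \<in> P" "base_point (F p) = x"
      using spin_structure_over_point[OF ss, of x] x by auto
    obtain U s where U: "smooth_local_section P F U s" "base_point (F p) \<in> U" "s (base_point (F p)) = p"
      "\<And>x. x \<in> U \<Longrightarrow> norm x = 1 \<and> 1 + base_point (F p) \<bullet> x > 0 \<and> F (s x) = moving_frame (F p) x"
      using moving_local_section[OF ss p(1)] by metis
    define V where "V = U \<inter> N"
    have secV: "smooth_local_section P F V s"
      unfolding V_def by (rule smooth_local_section_restrict[OF U(1) N(2)])
    interpret G: killing_gauge cl P F act A \<Psi> p V s
      by unfold_locales
        (use gk spin_structure_orthogonal[OF ss p(1)] secV U N p in \<open>auto simp: V_def\<close>)
    let ?f = "\<lambda>y. \<Psi> (s y) \<bullet> vol (\<Psi> (s y))"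
    \<comment> \<open>\<open>f\<close> does not vanish identically near \<open>x\<close>, as its derivative at \<open>x\<close> would then be zero\<close>
    have "\<exists>y\<in>V. ?f y \<noteq> 0"
    proof (rule ccontr)
      assume neg: "\<not> ?thesis"
      obtain X where X: "X \<bullet> x = 0" "cl_mult cl F p (A x X) (\<Psi>p p) \<bullet> \<Psi>m p \<noteq> 0"
        using rigid(1)[OF p(1) p(1) p(1) p(1) p(1)] assms(9) p(2) x by auto
      define a where "a = frame_coords (F p) (A x X)"
      have "cl a (\<Psi> p) \<bullet> vol (\<Psi> p) + \<Psi> p \<bullet> vol (cl a (\<Psi> p)) = 0"
        using G.chirality_derivative[OF vol(1), of X] neg X(1) p(2) by (auto simp: a_def)
      moreover have "\<Psi> p \<bullet> vol (cl a (\<Psi> p)) = cl a (\<Psi> p) \<bullet> vol (\<Psi> p)"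
        by (simp add: vol(2) skew)
      moreover have "vol (\<Psi> p) = \<Psi>p p - \<Psi>m p"
        using dec[OF p(1)] by (simp add: linear_add[OF vol(1)])
      ultimately have "cl a (\<Psi>p p + \<Psi>m p) \<bullet> (\<Psi>p p - \<Psi>m p) = 0" using dec(1)[OF p(1)] by simp
      then have "cl a (\<Psi>p p) \<bullet> \<Psi>m p = 0"
        using skew[of a "\<Psi>m p" "\<Psi>p p"] inner_commute[of "\<Psi>m p" "cl a (\<Psi>p p)"]
        unfolding linear_add[OF linear_cl] inner_add_left inner_diff_right cl_self_inner by linarith
      then show False using X(2) by (simp add: a_def cl_mult_def)
    qed
    then obtain y where y: "y \<in> V" "?f y \<noteq> 0" by blast
    have "continuous_on V (\<Psi> \<circ> s)" by (rule smooth_on_subset_continuous[OF G.smooth_spinor])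
    moreover have "continuous_on ((\<Psi> \<circ> s) ` V) vol"
      using vol(1) by (intro linear_continuous_on) (simp add: linear_conv_bounded_linear)
    ultimately have "continuous_on V ?f"
      using continuous_on_inner continuous_on_compose by (fastforce simp: o_def)
    then have "openin (top_of_set V) (V \<inter> ?f -` (- {0}))"
      by (intro continuous_openin_preimage_gen) auto
    then have "openin (top_of_set (sphere 0 1)) (V \<inter> ?f -` (- {0}))"
      using G.openU by (rule openin_trans)
    then obtain G where G: "open G" "V \<inter> ?f -` (- {0}) = sphere 0 1 \<inter> G" by (auto simp: openin_open)
    \<comment> \<open>the open set \<open>f \<noteq> 0\<close> around \<open>y\<close> meets the dense set \<open>\<eta> \<noteq> 0\<close>\<close>
    have "y \<in> V \<inter> ?f -` (- {0})" using y by blast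
    then have "y \<in> closure {x \<in> sphere 0 1. \<eta> x \<noteq> 0}" "y \<in> G"
      unfolding G(2) using assms(11) by blast+
    then obtain z where z: "z \<in> sphere 0 1" "\<eta> z \<noteq> 0" "z \<in> G"
      using open_Int_closure_eq_empty[OF G(1), of "{x \<in> sphere 0 1. \<eta> x \<noteq> 0}"] by blast
    then have "z \<in> V \<inter> ?f -` (- {0})" unfolding G(2) by blast
    then have zV: "z \<in> V" "?f z \<noteq> 0" by blast+
    then have "s z \<in> P" "base_point (F (s z)) = z" using secV by (auto simp: smooth_local_section_def)
    then have "z \<in> K" using inK[of "s z"] z(2) zV(2) by simp
    then show "K \<inter> M \<noteq> {}" using zV(1) N(1) by (auto simp: V_def)
  qed
  then have "closure {x \<in> sphere 0 1. \<eta> x \<noteq> 0} \<subseteq> closure K" by (intro closure_minimal) auto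
  then have cover: "sphere 0 1 \<subseteq> K" using assms(11) closedK by (simp add: closure_closed)
  have disj: "scalar_points A (1/2) \<inter> scalar_points A (- 1/2) = {}"
  proof (rule ccontr)
    assume "\<not> ?thesis"
    then obtain x where x: "x \<in> scalar_points A (1/2)" "x \<in> scalar_points A (- 1/2)" by blast
    then have "norm x = 1" by (simp add: scalar_points_def)
    then obtain p where p: "p \<in> P" "base_point (F p) = x"
      using spin_structure_over_point[OF ss] by blast
    define X where "X = frame_vec (F p) undefined"
    have X: "X \<bullet> x = 0" "X \<bullet> X = 1"
      using frame_orthonormal[OF spin_structure_orthogonal[OF ss p(1)]] p(2) by (auto simp: X_def)
    have "(1/2) *\<^sub>R X = (- 1/2) *\<^sub>R X" using x X(1) by (simp add: scalar_points_def)
    then have "X = 0" by (simp add: scaleR_cancel_right)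
    then show False using X(2) by simp
  qed
  have "connected (sphere 0 1 :: (real ^ 'n option) set)"
    using n3 by (intro connected_sphere) simp
  then have "scalar_points A (1/2) \<inter> sphere 0 1 = {} \<or> scalar_points A (- 1/2) \<inter> sphere 0 1 = {}"
    by (rule connected_closedD) (use disj cover closed_scalar_points[OF sA] in \<open>auto simp: K_def\<close>)
  then have "sphere 0 1 \<subseteq> scalar_points A (1/2) \<or> sphere 0 1 \<subseteq> scalar_points A (- 1/2)"
    using cover unfolding K_def by blast
  then obtain c where c: "c \<noteq> 0" "sphere 0 1 \<subseteq> scalar_points A c"
    using that[of "1/2"] that[of "- 1/2"] by auto
  have "generalized_killing_with cl P F act (\<lambda>x X. c *\<^sub>R X) \<Psi>"
    unfolding generalized_killing_with_def
  proof (intro conjI allI impI ballI)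
    fix U s x X assume sec: "smooth_local_section P F U s" and x: "x \<in> U" and X: "X \<bullet> x = 0"
    have "x \<in> sphere 0 1"
      using sec x unfolding smooth_local_section_def using openin_imp_subset by blast
    then have "A x X = c *\<^sub>R X" using c(2) X by (auto simp: scalar_points_def)
    then show "spin_nabla cl F s \<Psi> x X = cl_mult cl F (s x) (c *\<^sub>R X) (\<Psi> (s x))"
      using gk sec x X unfolding generalized_killing_with_def by metis
  qed (use gk symmetric_endo_field_scalar in \<open>auto simp: generalized_killing_with_def\<close>)
  then show ?thesis using c(1) unfolding killing_spinor_def by blast
qed

end
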